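(* Let $n\ge 1$. Let $\varphi\colon\mathbb{R}^n\to\mathbb{R}_+\cup\{+\infty\}$ be lower semicontinuous. Let $L\colon\mathbb{R}^n\times\mathbb{R}^n\to\mathbb{R}_+$ be locally bounded and lower semicontinuous (not necessarily continuous), with $L(x,\cdot)$ convex for every $x\in\mathbb{R}^n$, and suppose there exists a function $\Theta\colon\mathbb{R}^n\to\mathbb{R}_+$ with $\lim_{|u|\to\infty}\Theta(u)/|u|=+\infty$ and $L(x,u)\ge\Theta(u)$ for all $(x,u)\in\mathbb{R}^n\times\mathbb{R}^n$. Let $H$ be the Hamiltonian and $V$ the value function associated with $L$ and $\varphi$ (defined in the context). Let $W\colon\mathbb{R}_+\times\mathbb{R}^n\to\mathbb{R}_+\cup\{+\infty\}$ be a lower semicontinuous function such that: (i) for every $(t,x)\in\mathrm{dom}(W)$ with $t>0$, $D_\uparrow W(t,x)(0,0)=0$; (ii) for every $(t,x)\in\mathrm{dom}(W)$ with $t>0$ there exists $u\in\mathbb{R}^n$ such that $D_\uparrow W(t,x)(-1,u)<+\infty$; (iii) $W(0,\cdot)=\varphi$ on $\mathbb{R}^n$; (iv) ($W$ is a viscosity supersolution of the Hamilton-Jacobi equation) for every $(t,x)\in\mathbb{R}_+^\star\times\mathbb{R}^n$ and every $(p_t,p_x)\in\partial_-W(t,x)$, $\ p_t+H(x,-p_x)\ge0$. Then $W\ge V$ on $\mathbb{R}_+\times\mathbb{R}^n$.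
   Context: Notation: $\mathbb{R}_+=[0,+\infty)$, $\mathbb{R}_+^\star=\mathbb{R}_+\setminus\{0\}$; $\langle\cdot,\cdot\rangle$ is the Euclidean scalar product and $|\cdot|$ the Euclidean norm. $\mathrm{dom}(W)$ is the set of points where $W$ is finite. The Hamiltonian is $H(x,p):=\sup_{u\in\mathbb{R}^n}\left(\langle p,u\rangle-L(x,u)\right)$ for $x,p\in\mathbb{R}^n$. The value function $V\colon\mathbb{R}_+\times\mathbb{R}^n\to\mathbb{R}_+\cup\{+\infty\}$ is $$V(t,x):=\min\left\{\int_0^tL(y(s),y'(s))\,ds+\varphi(y(t)):\ y\in W^{1,1}(0,t;\mathbb{R}^n),\ y(0)=x\right\},$$ with $V(0,x)=\varphi(x)$. Here $W^{1,1}(0,t;\mathbb{R}^n)$ is the space of absolutely continuous functions $y\colon[0,t]\to\mathbb{R}^n$. For a function $W$ of $z\in\mathbb{R}^m$ (here $m=n+1$, $z=(t,x)$) and a point $z\in\mathrm{dom}(W)$, the subdifferential is $$\partial_-W(z):=\left\{p\in\mathbb{R}^m:\ \liminf_{z'\to z}\frac{W(z')-W(z)-\langle p,z'-z\rangle}{|z'-z|}\ge0\right\}$$ (it is only defined at points of $\mathrm{dom}(W)$; conditions quantified over $\partial_-W(z)$ are void when $z\notin\mathrm{dom}(W)$), and the contingent directional derivative in the direction $w\in\mathbb{R}^m$ is $$D_\uparrow W(z)(w):=\liminf_{h\to0+,\ v\to w}\frac{W(z+hv)-W(z)}{h}\in[-\infty,+\infty].$$ *)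

theory Defs
  imports "HOL-Analysis.Analysis"
begin

definition lower_semicontinuous_on ::
    "'a::topological_space set \<Rightarrow> ('a \<Rightarrow> 'b::linorder) \<Rightarrow> bool" where
  "lower_semicontinuous_on S f \<longleftrightarrow>
     (\<forall>z\<in>S. \<forall>c < f z. \<forall>\<^sub>F z' in at z within S. c < f z')"

definition locally_bounded :: "('a::topological_space \<Rightarrow> 'b::metric_space) \<Rightarrow> bool" where
  "locally_bounded f \<longleftrightarrow> (\<forall>z. \<exists>U. open U \<and> z \<in> U \<and> bounded (f ` U))"

text \<open>
  Absolute continuity of a function on a set of reals. The finite families of non-overlapping
  compact subintervals are those of \<^const>\<open>division_of\<close>, so \<open>K\<close> is the interval from \<open>Inf K\<close>
  to \<open>Sup K\<close>.
\<close>

definition absolutely_continuous_fun_on ::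
    "real set \<Rightarrow> (real \<Rightarrow> 'a::real_normed_vector) \<Rightarrow> bool" where
  "absolutely_continuous_fun_on S f \<longleftrightarrow>
     (\<forall>\<epsilon>>0. \<exists>\<delta>>0. \<forall>d T. d division_of T \<and> T \<subseteq> S \<and> (\<Sum>K\<in>d. Sup K - Inf K) < \<delta> \<longrightarrow>
        (\<Sum>K\<in>d. norm (f (Sup K) - f (Inf K))) < \<epsilon>)"

text \<open>
  Functions into \<open>\<real> \<union> {+\<infinity>}\<close> are \<^typ>\<open>ereal\<close>-valued. A function on a subset of the type is a total
  function whose values outside that subset play no role.
\<close>

definition finite_dom :: "('a \<Rightarrow> ereal) \<Rightarrow> 'a set" where
  "finite_dom W = {z. \<bar>W z\<bar> \<noteq> \<infinity>}"

definition subdifferential ::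
    "('a::real_inner \<Rightarrow> ereal) \<Rightarrow> 'a \<Rightarrow> 'a set" where
  "subdifferential W z =
     {p. z \<in> finite_dom W \<and>
         Liminf (at z) (\<lambda>z'. (W z' - W z - ereal (p \<bullet> (z' - z))) / ereal (norm (z' - z))) \<ge> 0}"

text \<open>In the lower limit over \<open>h \<rightarrow> 0+\<close>, \<open>v \<rightarrow> w\<close> the value \<open>v = w\<close> is allowed.\<close>

definition contingent_derivative ::
    "('a::real_normed_vector \<Rightarrow> ereal) \<Rightarrow> 'a \<Rightarrow> 'a \<Rightarrow> ereal" where
  "contingent_derivative W z w =
     Liminf (at_right 0 \<times>\<^sub>F nhds w) (\<lambda>(h, v). (W (z + h *\<^sub>R v) - W z) / ereal h)"

definition hamiltonian ::
    "('a::real_inner \<Rightarrow> 'a \<Rightarrow> real) \<Rightarrow> 'a \<Rightarrow> 'a \<Rightarrow> ereal" where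
  "hamiltonian L x p = (SUP u. ereal (p \<bullet> u - L x u))"

text \<open>
  For \<open>L \<ge> 0\<close> the running cost is an integral in \<open>[0, +\<infinity>]\<close>. An absolutely continuous \<open>y\<close> with
  values in a Euclidean space is differentiable almost everywhere, so the arbitrary value of
  \<^const>\<open>vector_derivative\<close> at the remaining points does not affect it.
\<close>

definition trajectory_cost ::
    "('a::real_normed_vector \<Rightarrow> 'a \<Rightarrow> real) \<Rightarrow> ('a \<Rightarrow> ereal) \<Rightarrow> real \<Rightarrow> (real \<Rightarrow> 'a) \<Rightarrow> ereal" where
  "trajectory_cost L \<phi> t y =
     enn2ereal (\<integral>\<^sup>+ s\<in>{0..t}. ennreal (L (y s) (vector_derivative y (at s within {0..t}))) \<partial>lebesgue)
       + \<phi> (y t)"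

definition value_function ::
    "('a::real_normed_vector \<Rightarrow> 'a \<Rightarrow> real) \<Rightarrow> ('a \<Rightarrow> ereal) \<Rightarrow> real \<Rightarrow> 'a \<Rightarrow> ereal" where
  "value_function L \<phi> t x =
     (INF y \<in> {y. absolutely_continuous_fun_on {0..t} y \<and> y 0 = x}. trajectory_cost L \<phi> t y)"

text \<open>The convention \<open>V(0,x) = \<phi>(x)\<close> is a consequence of the definition.\<close>

lemma value_function_0: "value_function L \<phi> 0 x = \<phi> x"
proof -
  have null: "(\<integral>\<^sup>+ s\<in>{0..0::real}. f s \<partial>lebesgue) = 0" for f :: "real \<Rightarrow> ennreal"
  proof -
    have "AE s in lebesgue. s \<noteq> (0::real)"
      by (rule AE_I'[where N = "{0}"]) auto
    then have "(\<integral>\<^sup>+ s\<in>{0..0}. f s \<partial>lebesgue) = (\<integral>\<^sup>+ s. 0 \<partial>(lebesgue :: real measure))"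
      by (intro nn_integral_cong_AE) (auto elim!: eventually_mono)
    then show ?thesis by simp
  qed
  have cost: "trajectory_cost L \<phi> 0 y = \<phi> (y 0)" for y
    unfolding trajectory_cost_def null by (simp add: zero_ennreal.rep_eq)
  have "absolutely_continuous_fun_on {0..0} (\<lambda>_. x)"
    unfolding absolutely_continuous_fun_on_def by (auto intro: exI[of _ 1])
  then show ?thesis
    unfolding value_function_def cost
    by (intro antisym INF_lower2[of "\<lambda>_. x"] INF_greatest) auto
qed

end

theory Submission
  imports Defs "HOL-Complex_Analysis.Great_Picard"
begin

text \<open>
  The epigraph \<open>K\<close> of \<open>W\<close> is viable under the directions \<open>(-1, u, -L(x, u))\<close>, rescaled so that time
  plus cost decreases at unit rate: for a proximal normal \<open>(p\<^sub>t, p\<^sub>x, -q)\<close> of \<open>K\<close> with \<open>q > 0\<close> the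
  supersolution inequality yields a direction making no acute angle with it, for \<open>q = 0\<close> and \<open>p\<^sub>x \<noteq> 0\<close> a
  large \<open>u\<close> does, and \<open>p\<^sub>x = 0\<close> is settled by the finite contingent derivative. Euler polygons aimed at
  closest points of \<open>K\<close> therefore converge to a curve in \<open>K\<close> from \<open>(t, x, W(t, x))\<close> to time \<open>0\<close>.
  Parametrized by time, it is an absolutely continuous \<open>y\<close> with a monotone accumulated cost \<open>c\<close>. By
  lower semicontinuity and convexity, \<open>L(y, y') \<le> c'\<close> wherever both derivatives exist, which is almost
  everywhere by Lebesgue's theorem on monotone functions; hence
  \<open>\<integral> L(y, y') + \<phi>(y(t)) \<le> W(t, x)\<close>.
\<close>

section \<open>Differentiability of monotone functions\<close>

text \<open>The velocities u range over the whole space and L(x, u) is unbounded in u, so the raw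
  directions (-1, u, -L) are unbounded; dividing by 1 + L bounds them because L grows superlinearly.
  The price is that for large |u| the rescaled direction tends to (0, 0, -1): along the limit curve
  time may stand still while cost is spent. Hence c may jump, and the absolute continuity of y must
  come from the growth of L rather than from c. The jumps are harmless: the derivative of a monotone
  function integrates to at most its increase, which is the inequality wanted.

  Since L is only lower semicontinuous, its values along the polygons need not converge. The limit
  curve is therefore described not by a differential inclusion but by linear inequalities tested
  against affine minorants of L that hold near a point of the curve.

  The supersolution inequality speaks only of normals with q > 0, since only these produce
  subgradients. This is why the horizontal normals are treated separately and why the contingent
  derivative enters.\<close>

text \<open>An interval is the closed ball about its midpoint, so Vitali's theorem for balls applies
  even when x is an end point. Passing to open intervals loses only countably many end points and
  makes the union open, so that a second covering can be chosen inside it.\<close>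

lemma Vitali_covering_intervals:
  fixes S :: "real set" and R :: "real \<Rightarrow> real \<Rightarrow> bool"
  assumes "open G" "S \<subseteq> G"
    and fine: "\<And>x d. \<lbrakk>x \<in> S; 0 < d\<rbrakk> \<Longrightarrow> \<exists>u v. R u v \<and> u < v \<and> u \<le> x \<and> x \<le> v \<and> v - u < d"
  obtains C where "countable C"
    "\<And>i. i \<in> C \<Longrightarrow> R (fst i) (snd i) \<and> fst i < snd i \<and> {fst i..snd i} \<subseteq> G"
    "disjoint_family_on (\<lambda>i. {fst i<..<snd i}) C" "negligible (S - (\<Union>i\<in>C. {fst i<..<snd i}))"
proof -
  define K where "K = {(u, v). R u v \<and> u < v \<and> {u..v} \<subseteq> G}"
  let ?a = "\<lambda>i. (fst i + snd i) / 2 :: real" and ?r = "\<lambda>i. (snd i - fst i) / 2 :: real"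
  have cball: "cball (?a i) (?r i) = {fst i..snd i}" for i
    by (simp add: cball_eq_atLeastAtMost field_simps)
  obtain C where C: "countable C" "C \<subseteq> K"
    "pairwise (\<lambda>i j. disjnt (cball (?a i) (?r i)) (cball (?a j) (?r j))) C"
    "negligible (S - (\<Union>i\<in>C. cball (?a i) (?r i)))"
  proof (rule Vitali_covering_theorem_cballs[of K ?r S ?a])
    show "0 < ?r i" if "i \<in> K" for i using that by (auto simp: K_def)
    fix x and d :: real assume x: "x \<in> S" and d: "0 < d"
    then obtain e where e: "e > 0" "cball x e \<subseteq> G"
      using assms(1,2) by (meson open_contains_cball subsetD)
    obtain u v where uv: "R u v" "u < v" "u \<le> x" "x \<le> v" "v - u < min d e"
      using fine[OF x, of "min d e"] d e by auto
    have "{u..v} \<subseteq> cball x e" using uv by (auto simp: dist_real_def)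
    then have "(u, v) \<in> K" using uv e by (auto simp: K_def)
    then show "\<exists>i. i \<in> K \<and> x \<in> cball (?a i) (?r i) \<and> ?r i < d"
      using uv cball[of "(u, v)"] by (intro exI[of _ "(u, v)"]) auto
  qed
  show ?thesis
  proof
    show "countable C" by fact
    show "R (fst i) (snd i) \<and> fst i < snd i \<and> {fst i..snd i} \<subseteq> G" if "i \<in> C" for i
    proof -
      have "i \<in> K" using that C(2) by blast
      then show ?thesis by (cases i) (simp add: K_def)
    qed
    have "{fst i<..<snd i} \<inter> {fst j<..<snd j} = {}" if "i \<in> C" "j \<in> C" "i \<noteq> j" for i j
    proof -
      have "{fst i..snd i} \<inter> {fst j..snd j} = {}"
        using C(3) that unfolding cball pairwise_def disjnt_def by blast
      moreover have "{fst k<..<snd k} \<subseteq> {fst k..snd k}" for k :: "real \<times> real" by auto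
      ultimately show ?thesis by blast
    qed
    then show "disjoint_family_on (\<lambda>i. {fst i<..<snd i}) C"
      unfolding disjoint_family_on_def by blast
    have "negligible (fst ` C \<union> snd ` C)"
      using C(1) by (simp add: countable_imp_null_set_lborel negligible_iff_null_sets null_sets_completionI)
    then have "negligible ((S - (\<Union>i\<in>C. {fst i..snd i})) \<union> (fst ` C \<union> snd ` C))"
      using C(4) unfolding cball by (rule negligible_Un[rotated])
    moreover have "{fst i..snd i} \<subseteq> {fst i<..<snd i} \<union> {fst i, snd i}" for i :: "real \<times> real"
      by auto
    then have "S - (\<Union>i\<in>C. {fst i<..<snd i}) \<subseteq> (S - (\<Union>i\<in>C. {fst i..snd i})) \<union> (fst ` C \<union> snd ` C)"
      by fast
    ultimately show "negligible (S - (\<Union>i\<in>C. {fst i<..<snd i}))"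
      by (rule negligible_subset)
  qed
qed

text \<open>Disjoint nonempty open intervals are ordered, and f preserves the order of their end
  points. Intervals between end-point values replace the images of f, which need not be intervals
  where f jumps.\<close>

lemma disjoint_intervals_mono_image:
  fixes f :: "real \<Rightarrow> real"
  assumes "mono f" "{u<..<v} \<inter> {u'<..<v'} = {}" "u < v" "u' < v'"
  shows "{f u<..<f v} \<inter> {f u'<..<f v'} = {}"
proof -
  have "v \<le> u' \<or> v' \<le> u"
  proof (rule ccontr)
    assume "\<not> ?thesis"
    then have "max u u' < min v v'" using assms by auto
    then obtain m where "max u u' < m" "m < min v v'" using dense by blast
    then have "m \<in> {u<..<v} \<inter> {u'<..<v'}" by auto
    then show False using assms(2) by blast
  qed
  then have "f v \<le> f u' \<or> f v' \<le> f u" using \<open>mono f\<close> by (auto dest: monoD)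
  then show ?thesis by auto
qed

lemma emeasure_UN_open_intervals:
  fixes l r :: "'i \<Rightarrow> real"
  assumes "countable C" "disjoint_family_on (\<lambda>i. {l i<..<r i}) C"
    and "\<And>i. i \<in> C \<Longrightarrow> l i \<le> r i"
  shows "emeasure lborel (\<Union>i\<in>C. {l i<..<r i}) = (\<integral>\<^sup>+ i. ennreal (r i - l i) \<partial>count_space C)"
proof -
  have "emeasure lborel (\<Union>i\<in>C. {l i<..<r i})
      = (\<integral>\<^sup>+ i. emeasure lborel {l i<..<r i} \<partial>count_space C)"
    using assms by (intro emeasure_UN_countable) auto
  also have "\<dots> = (\<integral>\<^sup>+ i. ennreal (r i - l i) \<partial>count_space C)"
    using assms by (intro nn_integral_cong) auto
  finally show ?thesis .
qed

text \<open>For proofs about a set E not known to be measurable: M stands for its outer measure,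
  finite because E is bounded, and is attained by a measurable hull. It suffices to refute M >
  0.\<close>

lemma negligible_of_outer:
  fixes E :: "real set"
  assumes bdd: "E \<subseteq> {a..b}"
    and small: "\<And>M. \<lbrakk>0 < M; \<And>X. \<lbrakk>X \<in> sets lebesgue; E \<subseteq> X\<rbrakk> \<Longrightarrow> ennreal M \<le> emeasure lebesgue X;
       \<And>e. 0 < e \<Longrightarrow> \<exists>G. open G \<and> E \<subseteq> G \<and> emeasure lebesgue G \<le> ennreal (M + e)\<rbrakk> \<Longrightarrow> False"
  shows "negligible E"
proof (rule ccontr)
  assume neg: "\<not> negligible E"
  obtain H where H: "H \<in> sets lebesgue" "E \<subseteq> H" "outer_measure_of lebesgue E = emeasure lebesgue H"
    using outer_measure_of_attain[of E lebesgue] by auto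
  have min: "emeasure lebesgue H \<le> emeasure lebesgue X" if "X \<in> sets lebesgue" "E \<subseteq> X" for X
    using outer_measure_of_mono[of E X lebesgue] that H(3) by simp
  have "emeasure lebesgue H \<le> emeasure lebesgue {a..b}" using bdd by (intro min) auto
  also have "\<dots> < \<infinity>" by (simp add: emeasure_lborel_Icc_eq)
  finally have fin: "emeasure lebesgue H < \<infinity>" .
  define M where "M = measure lebesgue H"
  have M: "emeasure lebesgue H = ennreal M"
    using fin by (simp add: M_def emeasure_eq_ennreal_measure)
  have "M \<noteq> 0"
  proof
    assume "M = 0"
    then have "H \<in> null_sets lebesgue" using M H by auto
    then show False using neg H(2) negligible_subset negligible_iff_null_sets by blast
  qed
  then have pos: "M > 0" by (simp add: M_def zero_less_measure_iff order_neq_le_trans)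
  have outer: "\<exists>G. open G \<and> E \<subseteq> G \<and> emeasure lebesgue G \<le> ennreal (M + e)" if "0 < e" for e
  proof -
    obtain G where G: "open G" "H \<subseteq> G" "G - H \<in> lmeasurable" "emeasure lebesgue (G - H) < ennreal e"
      using sets_lebesgue_outer_open[OF H(1) \<open>0 < e\<close>] .
    have "emeasure lebesgue G = emeasure lebesgue H + emeasure lebesgue (G - H)"
      using G H by (subst plus_emeasure) (auto simp: Un_absorb1 fmeasurableD)
    also have "\<dots> \<le> ennreal (M + e)"
      using M G(4) that pos by (simp add: ennreal_plus add_left_mono less_imp_le)
    finally show ?thesis using G H by blast
  qed
  show False
  proof (rule small[OF pos])
    show "ennreal M \<le> emeasure lebesgue X" if "X \<in> sets lebesgue" "E \<subseteq> X" for X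
      unfolding M[symmetric] using that by (rule min)
  qed (rule outer)
qed

text \<open>A Vitali family of intervals of slope at least q has total increase at least q times its
  total length. The increases are lengths of disjoint intervals inside A. X is the union of the
  family together with the null set it misses.\<close>

lemma large_slope_measure:
  fixes f :: "real \<Rightarrow> real"
  assumes "mono f" "open G" "E \<subseteq> G" "0 \<le> q"
    and fine: "\<And>x d. \<lbrakk>x \<in> E; 0 < d\<rbrakk> \<Longrightarrow>
      \<exists>u v. f v - f u \<ge> q * (v - u) \<and> u < v \<and> u \<le> x \<and> x \<le> v \<and> v - u < d"
    and img: "\<And>u v. {u..v} \<subseteq> G \<Longrightarrow> u < v \<Longrightarrow> {f u<..<f v} \<subseteq> A" and "A \<in> sets lborel"
  obtains X where "X \<in> sets lebesgue" "E \<subseteq> X" "ennreal q * emeasure lebesgue X \<le> emeasure lborel A"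
proof -
  obtain C where C: "countable C"
    "\<And>i. i \<in> C \<Longrightarrow> f (snd i) - f (fst i) \<ge> q * (snd i - fst i) \<and> fst i < snd i \<and> {fst i..snd i} \<subseteq> G"
    "disjoint_family_on (\<lambda>i. {fst i<..<snd i}) C" "negligible (E - (\<Union>i\<in>C. {fst i<..<snd i}))"
    by (rule Vitali_covering_intervals[OF assms(2,3), where R = "\<lambda>u v. f v - f u \<ge> q * (v - u)"]) (use fine in blast)+
  let ?I = "\<Union>i\<in>C. {fst i<..<snd i}"
  define N where "N = E - ?I"
  have N: "negligible N" using C(4) by (simp add: N_def)
  have dis': "disjoint_family_on (\<lambda>i. {f (fst i)<..<f (snd i)}) C"
    using C(2,3) disjoint_intervals_mono_image[OF \<open>mono f\<close>] unfolding disjoint_family_on_def by simp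
  show thesis
  proof
    show "?I \<union> N \<in> sets lebesgue"
      using N C(1) by (intro sets.Un negligible_imp_sets sets.countable_UN') auto
    show "E \<subseteq> ?I \<union> N" by (auto simp: N_def)
    have mono': "fst i < snd i" "f (fst i) \<le> f (snd i)" if "i \<in> C" for i
      using C(2)[of i] that \<open>mono f\<close> by (auto simp: mono_def)
    have I: "?I \<in> sets borel" using C(1) by (intro sets.countable_UN') auto
    have "emeasure lebesgue (?I \<union> N) = emeasure lborel ?I"
      using N I by (simp add: emeasure_Un_null_set negligible_iff_null_sets)
    also have "\<dots> = (\<integral>\<^sup>+ i. ennreal (snd i - fst i) \<partial>count_space C)"
      using C(1) C(3) mono' by (intro emeasure_UN_open_intervals) (auto simp: less_imp_le)
    finally have "ennreal q * emeasure lebesgue (?I \<union> N)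
        = (\<integral>\<^sup>+ i. ennreal q * ennreal (snd i - fst i) \<partial>count_space C)"
      by (simp add: nn_integral_cmult)
    also have "\<dots> \<le> (\<integral>\<^sup>+ i. ennreal (f (snd i) - f (fst i)) \<partial>count_space C)"
    proof (rule nn_integral_mono)
      fix i assume "i \<in> space (count_space C)"
      then show "ennreal q * ennreal (snd i - fst i) \<le> ennreal (f (snd i) - f (fst i))"
        using C(2)[of i] \<open>0 \<le> q\<close> by (simp flip: ennreal_mult add: ennreal_leI)
    qed
    also have "\<dots> = emeasure lborel (\<Union>i\<in>C. {f (fst i)<..<f (snd i)})"
      using C(1) dis' mono' by (intro emeasure_UN_open_intervals[symmetric]) auto
    also have "\<dots> \<le> emeasure lborel A"
      using C(2) img \<open>A \<in> sets lborel\<close> by (intro emeasure_mono UN_least) force+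
    finally show "ennreal q * emeasure lebesgue (?I \<union> N) \<le> emeasure lborel A" .
  qed
qed


text \<open>Intervals with small slopes cover \<open>E\<close> efficiently; a second covering inside them by intervals
  with large slopes gives \<open>q |E| \<le> p |E|\<close>. The total increase of \<open>f\<close> over disjoint intervals \<open>[u, v]\<close>
  is the Lebesgue measure of the union of the disjoint intervals \<open>(f u, f v)\<close>.\<close>

lemma negligible_derivate_gap:
  fixes f :: "real \<Rightarrow> real"
  assumes "mono f" "0 < p" "p < q" "E \<subseteq> {a..b}"
    and small: "\<And>x d. \<lbrakk>x \<in> E; 0 < d\<rbrakk> \<Longrightarrow>
      \<exists>u v. f v - f u \<le> p * (v - u) \<and> u < v \<and> u \<le> x \<and> x \<le> v \<and> v - u < d"
    and large: "\<And>x d. \<lbrakk>x \<in> E; 0 < d\<rbrakk> \<Longrightarrow>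
      \<exists>u v. f v - f u \<ge> q * (v - u) \<and> u < v \<and> u \<le> x \<and> x \<le> v \<and> v - u < d"
  shows "negligible E"
proof (rule negligible_of_outer[OF \<open>E \<subseteq> {a..b}\<close>])
  fix M :: real
  assume M: "0 < M" and min: "\<And>X. \<lbrakk>X \<in> sets lebesgue; E \<subseteq> X\<rbrakk> \<Longrightarrow> ennreal M \<le> emeasure lebesgue X"
    and outer: "\<And>e. 0 < e \<Longrightarrow> \<exists>G. open G \<and> E \<subseteq> G \<and> emeasure lebesgue G \<le> ennreal (M + e)"
  \<comment> \<open>This makes p * (M + e) the midpoint of p * M and q * M.\<close>
  define e where "e = (q - p) * M / (2 * p)"
  have e: "e > 0" "p * (M + e) < q * M"
    using assms(2,3) M by (auto simp: e_def field_simps)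
  obtain G where G: "open G" "E \<subseteq> G" "emeasure lebesgue G \<le> ennreal (M + e)"
    using outer[OF e(1)] by blast
  obtain C where C: "countable C"
    "\<And>i. i \<in> C \<Longrightarrow> f (snd i) - f (fst i) \<le> p * (snd i - fst i) \<and> fst i < snd i \<and> {fst i..snd i} \<subseteq> G"
    "disjoint_family_on (\<lambda>i. {fst i<..<snd i}) C" "negligible (E - (\<Union>i\<in>C. {fst i<..<snd i}))"
    by (rule Vitali_covering_intervals[OF G(1,2), where R = "\<lambda>u v. f v - f u \<le> p * (v - u)"]) (use small in blast)+
  let ?I = "\<Union>i\<in>C. {fst i<..<snd i}" and ?A = "\<Union>i\<in>C. {f (fst i)<..<f (snd i)}"
  define N where "N = E - ?I"
  have N: "negligible N" using C(4) by (simp add: N_def)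
  have dis': "disjoint_family_on (\<lambda>i. {f (fst i)<..<f (snd i)}) C"
    using C(2,3) disjoint_intervals_mono_image[OF \<open>mono f\<close>] unfolding disjoint_family_on_def by simp
  have mono': "fst i < snd i" "f (fst i) \<le> f (snd i)" if "i \<in> C" for i
    using C(2)[of i] that \<open>mono f\<close> by (auto simp: mono_def)
  have I: "?I \<in> sets borel" using C(1) by (intro sets.countable_UN') auto
  have A: "?A \<in> sets lborel" using C(1) by (intro sets.countable_UN') auto
  have EN: "E \<subseteq> ?I \<union> N" by (auto simp: N_def)
  have "emeasure lborel ?A = (\<integral>\<^sup>+ i. ennreal (f (snd i) - f (fst i)) \<partial>count_space C)"
    using C(1) dis' mono' by (intro emeasure_UN_open_intervals) auto
  also have "\<dots> \<le> (\<integral>\<^sup>+ i. ennreal p * ennreal (snd i - fst i) \<partial>count_space C)"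
  proof (rule nn_integral_mono)
    fix i assume "i \<in> space (count_space C)"
    then show "ennreal (f (snd i) - f (fst i)) \<le> ennreal p * ennreal (snd i - fst i)"
      using C(2)[of i] \<open>0 < p\<close> by (simp flip: ennreal_mult add: ennreal_leI)
  qed
  also have "\<dots> = ennreal p * emeasure lborel ?I"
    using C(1) C(3) mono' by (subst emeasure_UN_open_intervals) (auto simp: less_imp_le nn_integral_cmult)
  also have "emeasure lborel ?I \<le> emeasure lebesgue G"
  proof -
    have "emeasure lborel ?I \<le> emeasure lborel G"
      using C(2) G(1) by (intro emeasure_mono UN_least) force+
    then show ?thesis using G(1) by simp
  qed
  also note G(3)
  finally have A_le: "emeasure lborel ?A \<le> ennreal (p * (M + e))"
    using assms(2) M e by (simp add: ennreal_mult mult_left_mono)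
  obtain X where X: "X \<in> sets lebesgue" "E \<inter> ?I \<subseteq> X" "ennreal q * emeasure lebesgue X \<le> emeasure lborel ?A"
  proof (rule large_slope_measure[OF \<open>mono f\<close>, of ?I "E \<inter> ?I" q ?A])
    show "{f u<..<f v} \<subseteq> ?A" if uv: "{u..v} \<subseteq> ?I" "u < v" for u v
    proof -
      have u: "u \<in> {u..v}" using uv(2) by auto
      then obtain i where i: "i \<in> C" "u \<in> {fst i<..<snd i}" using uv(1) by blast
      \<comment> \<open>A connected set covered by disjoint open intervals lies in one of them, so
        the increase of f over {u..v} falls into a single piece of \<open>?A\<close>.\<close>
      have "{fst i<..<snd i} \<inter> {u..v} = {} \<or> (\<Union>j\<in>C - {i}. {fst j<..<snd j}) \<inter> {u..v} = {}"
      proof (rule connectedD[of "{u..v}"])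
        show "{fst i<..<snd i} \<inter> (\<Union>j\<in>C - {i}. {fst j<..<snd j}) \<inter> {u..v} = {}"
          using C(3) i(1) unfolding disjoint_family_on_def by blast
        show "{u..v} \<subseteq> {fst i<..<snd i} \<union> (\<Union>j\<in>C - {i}. {fst j<..<snd j})"
          using uv(1) by blast
      qed auto
      then have sub: "{u..v} \<subseteq> {fst i<..<snd i}" using uv(1) u i(2) by blast
      moreover have "v \<in> {u..v}" using uv(2) by auto
      ultimately have "fst i < u" "v < snd i" using i(2) by (blast dest: greaterThanLessThan_iff[THEN iffD1])+
      then have "{f u<..<f v} \<subseteq> {f (fst i)<..<f (snd i)}"
        using monoD[OF \<open>mono f\<close>, of "fst i" u] monoD[OF \<open>mono f\<close>, of v "snd i"] by auto
      then show ?thesis using i(1) by blast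
    qed
    show "open ?I" by (intro open_UN ballI open_greaterThanLessThan)
    show "0 \<le> q" using assms(2,3) by simp
    show "\<exists>u v. f v - f u \<ge> q * (v - u) \<and> u < v \<and> u \<le> x \<and> x \<le> v \<and> v - u < d"
      if "x \<in> E \<inter> ?I" "0 < d" for x d using that by (intro large) auto
  qed (use A in auto)
  have "ennreal M \<le> emeasure lebesgue (X \<union> N)"
    using EN X N by (intro min) (auto intro: negligible_imp_sets)
  also have "\<dots> = emeasure lebesgue X"
    using N X by (simp add: emeasure_Un_null_set negligible_iff_null_sets)
  finally have "ennreal q * ennreal M \<le> ennreal q * emeasure lebesgue X" by (rule mult_left_mono) simp
  also have "\<dots> \<le> ennreal (p * (M + e))" using X(3) A_le by (rule order_trans)
  finally have "q * M \<le> p * (M + e)"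
    using assms(2,3) M e(1) by (simp flip: ennreal_mult)
  then show False using e(2) by simp
qed

text \<open>If M were the outer measure of E, then q * M would be bounded by the increase of f over
  [a - 1, b + 1] for every q. The margin 1 leaves room for the covering intervals to stick out of
  [a, b].\<close>

lemma negligible_infinite_derivate:
  fixes f :: "real \<Rightarrow> real"
  assumes "mono f" "E \<subseteq> {a..b}"
    and large: "\<And>q x d. \<lbrakk>x \<in> E; 0 < d\<rbrakk> \<Longrightarrow>
      \<exists>u v. f v - f u \<ge> q * (v - u) \<and> u < v \<and> u \<le> x \<and> x \<le> v \<and> v - u < d"
  shows "negligible E"
proof (rule negligible_of_outer[OF \<open>E \<subseteq> {a..b}\<close>])
  fix M :: real
  assume M: "0 < M" and min: "\<And>X. \<lbrakk>X \<in> sets lebesgue; E \<subseteq> X\<rbrakk> \<Longrightarrow> ennreal M \<le> emeasure lebesgue X"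
  define D where "D = max 0 (f (b + 1) - f (a - 1))"
  define q where "q = (D + 1) / M"
  have q: "0 \<le> q" "q * M = D + 1" using M by (auto simp: q_def D_def)
  obtain X where X: "X \<in> sets lebesgue" "E \<subseteq> X"
    "ennreal q * emeasure lebesgue X \<le> emeasure lborel {f (a - 1)<..<f (b + 1)}"
  proof (rule large_slope_measure[OF \<open>mono f\<close>, of "{a - 1<..<b + 1}" E q])
    show "{f u<..<f v} \<subseteq> {f (a - 1)<..<f (b + 1)}" if "{u..v} \<subseteq> {a - 1<..<b + 1}" "u < v" for u v
    proof -
      have "u \<in> {u..v}" "v \<in> {u..v}" using that by auto
      then have "u \<in> {a - 1<..<b + 1}" "v \<in> {a - 1<..<b + 1}" using that by blast+
      then have "f (a - 1) \<le> f u" "f v \<le> f (b + 1)"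
        by (simp_all add: monoD[OF \<open>mono f\<close>])
      then show ?thesis by auto
    qed
    show "\<exists>u v. f v - f u \<ge> q * (v - u) \<and> u < v \<and> u \<le> x \<and> x \<le> v \<and> v - u < d"
      if "x \<in> E" "0 < d" for x d using that by (rule large)
    show "E \<subseteq> {a - 1<..<b + 1}" using \<open>E \<subseteq> {a..b}\<close> by auto
  qed (use q in auto)
  have "emeasure lborel {f (a - 1)<..<f (b + 1)} \<le> ennreal D"
    by (cases "f (a - 1) \<le> f (b + 1)") (auto simp: D_def)
  have "ennreal q * ennreal M \<le> ennreal q * emeasure lebesgue X"
    using min X by (intro mult_left_mono) auto
  also have "\<dots> \<le> ennreal D" using X(3) \<open>_ \<le> ennreal D\<close> by (rule order_trans)
  finally have "q * M \<le> D" using q(1) M by (simp flip: ennreal_mult add: D_def)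
  then show False using q(2) by simp
qed

text \<open>Slopes are taken over all short intervals containing x, so there is one upper and one
  lower derivate instead of four Dini derivates. Off \<open>Linf\<close> the upper one is finite; if
  the lower one were smaller, rationals between them would put x into some
  \<open>Gap p q\<close>.\<close>

theorem mono_imp_differentiable_AE:
  fixes f :: "real \<Rightarrow> real"
  assumes "mono f"
  shows "AE x in lebesgue. f field_differentiable (at x)"
proof -
  define I where "I P x \<longleftrightarrow> (\<forall>d>0. \<exists>u v. P u v \<and> u < v \<and> u \<le> x \<and> x \<le> v \<and> v - u < d)"
    for P and x :: real
  define Linf where "Linf = {x. \<forall>q. I (\<lambda>u v. f v - f u \<ge> q * (v - u)) x}"
  define Gap where "Gap p q = {x. I (\<lambda>u v. f v - f u \<le> p * (v - u)) x \<and>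
    I (\<lambda>u v. f v - f u \<ge> q * (v - u)) x}" for p q
  have cover: "negligible E" if "\<And>n::nat. negligible (E \<inter> {- real n..real n})" for E
  proof -
    have "E = (\<Union>n. E \<inter> {- real n..real n})"
    proof (intro equalityI subsetI)
      fix x assume "x \<in> E"
      moreover obtain n where "\<bar>x\<bar> \<le> real n" using real_arch_simple by blast
      ultimately have "x \<in> E \<inter> {- real n..real n}" by auto
      then show "x \<in> (\<Union>n. E \<inter> {- real n..real n})" by blast
    qed auto
    moreover have "negligible (\<Union>n. E \<inter> {- real n..real n})"
      using that by (intro negligible_countable_Union) auto
    ultimately show ?thesis by simp
  qed
  have 1: "negligible Linf"
    by (rule cover, rule negligible_infinite_derivate[OF assms Int_lower2]) (auto simp: Linf_def I_def)
  have 2: "negligible (Gap p q)" if "0 < p" "p < q" for p q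
    by (rule cover, rule negligible_derivate_gap[OF assms that Int_lower2]) (auto simp: Gap_def I_def)
  define P where "P = {(p :: real, q :: real). p \<in> \<rat> \<and> q \<in> \<rat> \<and> 0 < p \<and> p < q}"
  have "countable P" by (rule countable_subset[of _ "\<rat> \<times> \<rat>"]) (auto simp: P_def countable_rat)
  then have "negligible (\<Union>(p, q)\<in>P. Gap p q)"
    by (rule negligible_countable_Union[OF countable_image]) (auto simp: P_def intro: 2)
  with 1 have N: "negligible (Linf \<union> (\<Union>(p, q)\<in>P. Gap p q))" by (rule negligible_Un)
  have "f field_differentiable (at x)" if x: "x \<notin> Linf" "\<And>p q. (p, q) \<in> P \<Longrightarrow> x \<notin> Gap p q" for x
  proof -
    \<comment> \<open>The eventual upper bounds of the slopes at x; \<open>D = Inf B\<close> below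
      is the upper derivate.\<close>
    define B where "B = {q. \<exists>d>0. \<forall>u v. u < v \<longrightarrow> u \<le> x \<longrightarrow> x \<le> v \<longrightarrow> v - u < d \<longrightarrow> f v - f u < q * (v - u)}"
    have notI: "\<exists>d>0. \<forall>u v. u < v \<longrightarrow> u \<le> x \<longrightarrow> x \<le> v \<longrightarrow> v - u < d \<longrightarrow> \<not> Q u v" if "\<not> I Q x" for Q
    proof -
      obtain d where d: "d > 0" "\<not> (\<exists>u v. Q u v \<and> u < v \<and> u \<le> x \<and> x \<le> v \<and> v - u < d)"
        using \<open>\<not> I Q x\<close> unfolding I_def by auto
      have "\<not> Q u v" if "u < v" "u \<le> x" "x \<le> v" "v - u < d" for u v
        using d(2) that by auto
      then show ?thesis using d(1) by (intro exI[of _ d]) simp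
    qed
    obtain q0 where "\<not> I (\<lambda>u v. f v - f u \<ge> q0 * (v - u)) x" using x(1) by (auto simp: Linf_def)
    from notI[OF this] have "q0 \<in> B" by (auto simp: B_def not_le)
    have pos: "0 \<le> q" if q: "q \<in> B" for q
    proof -
      obtain d where d: "d > 0" "\<And>u v. u < v \<Longrightarrow> u \<le> x \<Longrightarrow> x \<le> v \<Longrightarrow> v - u < d \<Longrightarrow> f v - f u < q * (v - u)"
        using q unfolding B_def by blast
      have "f x \<le> f (x + d / 2)" using assms d(1) by (auto simp: mono_def)
      with d(2)[of x "x + d / 2"] d(1) have "0 < q * (d / 2)" by auto
      then show ?thesis using d(1) by (simp add: zero_less_mult_iff)
    qed
    then have bdd: "bdd_below B" by (rule bdd_belowI)
    define D where "D = Inf B"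
    have up: "\<exists>d>0. \<forall>u v. u < v \<longrightarrow> u \<le> x \<longrightarrow> x \<le> v \<longrightarrow> v - u < d \<longrightarrow> f v - f u < q * (v - u)"
      if q: "D < q" for q
    proof -
      obtain q' where q': "q' \<in> B" "q' < q"
        using cInf_lessD[of B q] q \<open>q0 \<in> B\<close> unfolding D_def by blast
      obtain d where d: "d > 0" "\<And>u v. u < v \<Longrightarrow> u \<le> x \<Longrightarrow> x \<le> v \<Longrightarrow> v - u < d \<Longrightarrow> f v - f u < q' * (v - u)"
        using q'(1) unfolding B_def by blast
      have "f v - f u < q * (v - u)" if "u < v" "u \<le> x" "x \<le> v" "v - u < d" for u v
      proof -
        have "q' * (v - u) \<le> q * (v - u)" using q' that by (intro mult_right_mono) auto
        then show ?thesis using d(2)[OF that] by linarith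
      qed
      then show ?thesis using d(1) by blast
    qed
    have low: "\<exists>d>0. \<forall>u v. u < v \<longrightarrow> u \<le> x \<longrightarrow> x \<le> v \<longrightarrow> v - u < d \<longrightarrow> f v - f u > p * (v - u)"
      if p: "p < D" for p
    proof (cases "p < 0")
      case True
      have "f v - f u > p * (v - u)" if "u < v" for u v
      proof -
        have "f u \<le> f v" using assms that by (auto simp: mono_def)
        moreover have "p * (v - u) < 0" using True that by (simp add: mult_neg_pos)
        ultimately show ?thesis by auto
      qed
      then show ?thesis by (intro exI[of _ 1]) auto
    next
      case False
      \<comment> \<open>Two rationals below D: slopes of at least q' recur since q' is not in
        \<open>B\<close>, so slopes of at most p' cannot recur, or x would lie in
        \<open>Gap p' q'\<close>.\<close>
      obtain p' where p': "p < p'" "p' < D" "p' \<in> \<rat>" using Rats_dense_in_real[OF p] by blast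
      obtain q' where q': "p' < q'" "q' < D" "q' \<in> \<rat>" using Rats_dense_in_real[OF p'(2)] by blast
      have "q' \<notin> B" using q'(2) cInf_lower[OF _ bdd, of q'] unfolding D_def by auto
      have "I (\<lambda>u v. f v - f u \<ge> q' * (v - u)) x"
      proof (rule ccontr)
        assume "\<not> ?thesis"
        from notI[OF this] have "q' \<in> B" by (auto simp: B_def not_le)
        with \<open>q' \<notin> B\<close> show False by blast
      qed
      moreover have "x \<notin> Gap p' q'" using False p' q' by (intro x(2)) (auto simp: P_def)
      ultimately have "\<not> I (\<lambda>u v. f v - f u \<le> p' * (v - u)) x" by (simp add: Gap_def)
      from notI[OF this] obtain d where d: "d > 0"
        "\<And>u v. u < v \<Longrightarrow> u \<le> x \<Longrightarrow> x \<le> v \<Longrightarrow> v - u < d \<Longrightarrow> f v - f u > p' * (v - u)"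
        by (auto simp: not_le)
      have "f v - f u > p * (v - u)" if "u < v" "u \<le> x" "x \<le> v" "v - u < d" for u v
      proof -
        have "p * (v - u) \<le> p' * (v - u)" using p' that by (intro mult_right_mono) auto
        then show ?thesis using d(2)[OF that] by linarith
      qed
      then show ?thesis using d(1) by blast
    qed
    have "((\<lambda>y. (f y - f x) / (y - x)) \<longlongrightarrow> D) (at x)"
      unfolding tendsto_iff
    proof (intro allI impI)
      fix e :: real assume e: "e > 0"
      obtain d1 where d1: "d1 > 0" "\<And>u v. u < v \<Longrightarrow> u \<le> x \<Longrightarrow> x \<le> v \<Longrightarrow> v - u < d1 \<Longrightarrow> f v - f u < (D + e) * (v - u)"
        using up[of "D + e"] e by auto
      obtain d2 where d2: "d2 > 0" "\<And>u v. u < v \<Longrightarrow> u \<le> x \<Longrightarrow> x \<le> v \<Longrightarrow> v - u < d2 \<Longrightarrow> f v - f u > (D - e) * (v - u)"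
        using low[of "D - e"] e by auto
      have "dist ((f y - f x) / (y - x)) D < e" if y: "y \<noteq> x" "dist y x < min d1 d2" for y
      proof -
        define u where "u = min x y"
        define v where "v = max x y"
        have uv: "u < v" "u \<le> x" "x \<le> v" "v - u < d1" "v - u < d2"
          using y by (auto simp: u_def v_def dist_real_def)
        have "(f y - f x) / (y - x) = (f v - f u) / (v - u)"
          using y(1) by (cases "x < y") (auto simp: u_def v_def field_simps)
        moreover have "(f v - f u) / (v - u) < D + e" "D - e < (f v - f u) / (v - u)"
          using d1(2)[OF uv(1-4)] d2(2)[OF uv(1-3,5)] uv(1) by (auto simp: field_simps)
        ultimately show ?thesis by (auto simp: dist_real_def)
      qed
      then show "\<forall>\<^sub>F y in at x. dist ((f y - f x) / (y - x)) D < e"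
        unfolding eventually_at using d1(1) d2(1) by (intro exI[of _ "min d1 d2"]) auto
    qed
    then show ?thesis unfolding field_differentiable_def has_field_derivative_iff by blast
  qed
  then show ?thesis
    using N by (intro AE_I'[where N = "Linf \<union> (\<Union>(p, q)\<in>P. Gap p q)"])
      (auto simp: negligible_iff_null_sets)
qed

section \<open>Integrated derivatives and total increase of monotone functions\<close>

text \<open>Fatou's lemma for the difference quotients with step h = 1 / (n + 1). In their integrals
  the shift by h leaves only the integrals of f over [b, b + h] and [a, a + h]: the first equals h *
  f b since f is constant beyond b, the second is at least h * f a.\<close>

lemma mono_nn_integral_derivative_le:
  fixes f G :: "real \<Rightarrow> real"
  assumes "mono f" "a \<le> b" and const: "\<And>s. b \<le> s \<Longrightarrow> f s = f b"
    and G: "AE s in lebesgue. s \<in> {a<..<b} \<longrightarrow> (\<exists>D. (f has_field_derivative D) (at s) \<and> G s \<le> D)"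
  shows "(\<integral>\<^sup>+ s\<in>{a..b}. ennreal (G s) \<partial>lebesgue) \<le> ennreal (f b - f a)"
proof -
  define q where "q n s = real (Suc n) * (f (s + 1 / real (Suc n)) - f s)" for n s
  have [measurable]: "f \<in> borel_measurable borel" using \<open>mono f\<close> by (rule borel_measurable_mono)
  have q_nonneg: "0 \<le> q n s" for n s
    using monoD[OF \<open>mono f\<close>, of s "s + 1 / real (Suc n)"] by (simp add: q_def)
  have q_int: "(\<integral>\<^sup>+ s. ennreal (indicator {a..b} s * q n s) \<partial>lebesgue) \<le> ennreal (f b - f a)" for n
  proof -
    define h where "h = 1 / real (Suc n)"
    have h: "h > 0" "real (Suc n) * h = 1" by (auto simp: h_def)
    have int: "f integrable_on {u..v}" for u v
      using \<open>mono f\<close> by (intro integrable_on_mono_on) (auto simp: mono_on_def mono_def)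
    have "((\<lambda>s. f (s + h)) has_integral integral {a + h..b + h} f) {a..b}"
      using has_integral_affinity'[of f "integral {a + h..b + h} f" "a + h" "b + h" 1 h] int[of "a + h" "b + h"]
      by (simp add: integrable_integral)
    moreover have "(f has_integral integral {a..b} f) {a..b}" using int by (rule integrable_integral)
    ultimately have "((\<lambda>s. real (Suc n) * (f (s + h) - f s)) has_integral
        real (Suc n) * (integral {a + h..b + h} f - integral {a..b} f)) {a..b}"
      by (intro has_integral_mult_right has_integral_diff)
    then have hi: "(q n has_integral real (Suc n) * (integral {a + h..b + h} f - integral {a..b} f)) {a..b}"
      by (simp add: q_def[abs_def] h_def)
    have "integral {a..a + h} f + integral {a + h..b + h} f = integral {a..b} f + integral {b..b + h} f"
      using h(1) \<open>a \<le> b\<close> int by (simp add: Henstock_Kurzweil_Integration.integral_combine)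
    moreover have "h * f a \<le> integral {a..a + h} f"
      using integral_le[of "\<lambda>_. f a" "{a..a + h}" f] int \<open>mono f\<close> h(1) by (auto simp: mono_def)
    moreover have "integral {b..b + h} f = integral {b..b + h} (\<lambda>_. f b)"
      by (intro integral_cong const) auto
    moreover have "integral {b..b + h} (\<lambda>_. f b) = h * f b" using h(1) by simp
    ultimately have "integral {a + h..b + h} f - integral {a..b} f \<le> h * (f b - f a)"
      unfolding right_diff_distrib by linarith
    from mult_left_mono[OF this, of "real (Suc n)"]
    have "real (Suc n) * (integral {a + h..b + h} f - integral {a..b} f)
        \<le> (real (Suc n) * h) * (f b - f a)" by (simp add: mult.assoc)
    then have "real (Suc n) * (integral {a + h..b + h} f - integral {a..b} f) \<le> f b - f a"
      by (simp only: h(2) mult_1)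
    then show ?thesis
      unfolding nn_integral_completion nn_integral_has_integral_lebesgue[OF q_nonneg hi]
      by (rule ennreal_leI)
  qed
  have "AE s in lebesgue. ennreal (G s) * indicator {a..b} s
      \<le> liminf (\<lambda>n. ennreal (indicator {a..b} s * q n s))"
  proof -
    have "AE s in lebesgue. s \<notin> {a, b}"
      by (intro AE_completion AE_not_in countable_imp_null_set_lborel) auto
    with G show ?thesis
    proof eventually_elim
      case (elim s)
      show ?case
      proof (cases "s \<in> {a<..<b}")
        case True
        then obtain D where D: "(f has_field_derivative D) (at s)" "G s \<le> D" using elim by auto
        have "(\<lambda>n. (f (s + 1 / real (Suc n)) - f s) / (1 / real (Suc n))) \<longlonglongrightarrow> D"
          using D(1)[unfolded DERIV_def]
          by (rule filterlim_compose) (use LIMSEQ_Suc[OF lim_const_over_n[of "1::real"]] in \<open>auto simp: filterlim_at\<close>)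
        then have "(\<lambda>n. q n s) \<longlonglongrightarrow> D" by (simp add: q_def[abs_def] mult.commute)
        then have "liminf (\<lambda>n. ennreal (q n s)) = ennreal D"
          by (intro lim_imp_Liminf tendsto_ennrealI) auto
        then show ?thesis using True D(2) by (simp add: ennreal_leI)
      qed (use elim in \<open>auto simp: indicator_def\<close>)
    qed
  qed
  then have "(\<integral>\<^sup>+ s\<in>{a..b}. ennreal (G s) \<partial>lebesgue)
      \<le> (\<integral>\<^sup>+ s. liminf (\<lambda>n. ennreal (indicator {a..b} s * q n s)) \<partial>lebesgue)"
    by (rule nn_integral_mono_AE)
  also have "\<dots> \<le> liminf (\<lambda>n. \<integral>\<^sup>+ s. ennreal (indicator {a..b} s * q n s) \<partial>lebesgue)"
    unfolding q_def by (intro nn_integral_liminf measurable_completion) measurable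
  also have "\<dots> \<le> ennreal (f b - f a)"
    by (intro Liminf_le always_eventually allI q_int sequentially_bot)
  finally show ?thesis .
qed

text \<open>The increments are lengths of disjoint intervals inside (f a, f b), so additivity of
  Lebesgue measure replaces sorting the division. Degenerate members contribute 0 and are removed
  first, as disjointness of the images needs nonempty open intervals.\<close>

lemma mono_sum_division_le:
  fixes f :: "real \<Rightarrow> real"
  assumes "mono f" "d division_of T" "T \<subseteq> {a..b}" "a \<le> b"
  shows "(\<Sum>K\<in>d. f (Sup K) - f (Inf K)) \<le> f b - f a"
proof -
  define P where "P = {K\<in>d. Inf K < Sup K}"
  have fin: "finite d" using assms(2) by auto
  have K: "\<exists>u v. K = {u..v} \<and> u \<le> v \<and> a \<le> u \<and> v \<le> b \<and> Inf K = u \<and> Sup K = v" if K: "K \<in> d" for K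
  proof -
    obtain u v where uv: "K = cbox u v" using division_ofD(4)[OF assms(2) K] by auto
    moreover have "K \<noteq> {}" "K \<subseteq> T" using division_ofD(2,3)[OF assms(2) K] by auto
    ultimately have "u \<le> v" "u \<in> {a..b}" "v \<in> {a..b}" using assms(3) by (simp_all add: subset_eq)
    then show ?thesis using uv by auto
  qed
  have int: "interior K = {Inf K<..<Sup K}" if "K \<in> d" for K
    using K[OF that] interior_atLeastAtMost_real by metis
  have "(\<Sum>K\<in>d. f (Sup K) - f (Inf K)) = (\<Sum>K\<in>P. f (Sup K) - f (Inf K))"
  proof (intro sum.mono_neutral_right ballI)
    fix K assume "K \<in> d - P"
    then have "Inf K = Sup K" using K[of K] by (auto simp: P_def)
    then show "f (Sup K) - f (Inf K) = 0" by simp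
  qed (use fin in \<open>auto simp: P_def\<close>)
  also have "ennreal \<dots> \<le> ennreal (f b - f a)"
  proof -
    have le: "f (Inf K) \<le> f (Sup K)" if "K \<in> P" for K
      using that \<open>mono f\<close> by (auto simp: P_def mono_def)
    have "ennreal (\<Sum>K\<in>P. f (Sup K) - f (Inf K)) = (\<Sum>K\<in>P. emeasure lborel {f (Inf K)<..<f (Sup K)})"
      using le by (subst sum_ennreal[symmetric]) auto
    also have "\<dots> = emeasure lborel (\<Union>K\<in>P. {f (Inf K)<..<f (Sup K)})"
    proof (rule sum_emeasure)
      show "disjoint_family_on (\<lambda>K. {f (Inf K)<..<f (Sup K)}) P"
        unfolding disjoint_family_on_def
      proof (intro ballI impI)
        fix K K' assume KP: "K \<in> P" "K' \<in> P" "K \<noteq> K'"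
        have "interior K \<inter> interior K' = {}"
          using division_ofD(5)[OF assms(2)] KP by (auto simp: P_def)
        then have "{Inf K<..<Sup K} \<inter> {Inf K'<..<Sup K'} = {}"
          using int KP by (simp add: P_def)
        then show "{f (Inf K)<..<f (Sup K)} \<inter> {f (Inf K')<..<f (Sup K')} = {}"
          using KP by (intro disjoint_intervals_mono_image[OF \<open>mono f\<close>]) (auto simp: P_def)
      qed
    qed (use fin in \<open>auto simp: P_def\<close>)
    also have "\<dots> \<le> emeasure lborel {f a<..<f b}"
    proof (intro emeasure_mono UN_least)
      fix K assume "K \<in> P"
      then have "f a \<le> f (Inf K)" "f (Sup K) \<le> f b"
        using K[of K] \<open>mono f\<close> by (auto simp: P_def mono_def)
      then show "{f (Inf K)<..<f (Sup K)} \<subseteq> {f a<..<f b}" by auto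
    qed auto
    also have "\<dots> = ennreal (f b - f a)" using monoD[OF \<open>mono f\<close> \<open>a \<le> b\<close>] by simp
    finally show ?thesis .
  qed
  finally show ?thesis using monoD[OF \<open>mono f\<close> \<open>a \<le> b\<close>] by simp
qed

section \<open>Viability by proximal aiming\<close>

text \<open>A step of size \<open>h\<close> making (almost) no acute angle with \<open>z - P z\<close>, where \<open>P z\<close> is a closest
  point of \<open>K\<close>, increases the squared distance to \<open>K\<close> only by \<open>O(h\<^sup>2)\<close>; over \<open>1/h\<close> steps the distance
  stays \<open>O(\<surd>h)\<close>.\<close>

lemma proximal_aiming_polygon:
  fixes K Stop :: "'a::euclidean_space set" and F :: "'a \<Rightarrow> 'a set"
  assumes K: "closed K" "z0 \<in> K" and h: "0 < h"
    and bound: "\<And>s v. s \<in> K \<Longrightarrow> v \<in> F s \<Longrightarrow> norm v \<le> M"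
    and aim: "\<And>z e. closest_point K z \<notin> Stop \<Longrightarrow> 0 < e \<Longrightarrow>
      \<exists>v\<in>F (closest_point K z). v \<bullet> (z - closest_point K z) \<le> e"
  obtains z V where "z 0 = z0" "\<And>i. z (Suc i) = z i + h *\<^sub>R V i"
    "\<And>i. if closest_point K (z i) \<in> Stop then V i = 0 else V i \<in> F (closest_point K (z i))"
    "\<And>i. (norm (z i - closest_point K (z i)))\<^sup>2 \<le> real i * (h\<^sup>2 * (M\<^sup>2 + 2))"
proof -
  let ?P = "closest_point K"
  \<comment> \<open>With tolerance h the cross term is at most 2 * h * h, of the same order as the
    quadratic term; hence the constant \<open>M\<^sup>2 + 2\<close>.\<close>
  have "\<exists>v. if ?P z \<in> Stop then v = 0 else v \<in> F (?P z) \<and> v \<bullet> (z - ?P z) \<le> h" for z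
    using aim[of z h] h by auto
  then obtain w where w: "\<And>z. if ?P z \<in> Stop then w z = 0 else w z \<in> F (?P z) \<and> w z \<bullet> (z - ?P z) \<le> h"
    by metis
  define z where "z i = ((\<lambda>z. z + h *\<^sub>R w z) ^^ i) z0" for i
  have z: "z 0 = z0" "\<And>i. z (Suc i) = z i + h *\<^sub>R w (z i)" by (simp_all add: z_def)
  have P: "?P y \<in> K" for y using K by (intro closest_point_in_set) auto
  have "(norm (z i - ?P (z i)))\<^sup>2 \<le> real i * (h\<^sup>2 * (M\<^sup>2 + 2))" for i
  proof (induction i)
    case 0
    then show ?case using K z by (simp add: closest_point_self)
  next
    case (Suc i)
    let ?n = "z i - ?P (z i)" and ?v = "w (z i)"
    have v: "?v \<bullet> ?n \<le> h" "(norm ?v)\<^sup>2 \<le> M\<^sup>2"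
    proof -
      have "norm ?v \<le> M" if "?P (z i) \<notin> Stop" using w[of "z i"] that bound P by auto
      then show "(norm ?v)\<^sup>2 \<le> M\<^sup>2" using w[of "z i"] by (cases "?P (z i) \<in> Stop") (auto intro: power_mono)
      show "?v \<bullet> ?n \<le> h" using w[of "z i"] h by (auto split: if_splits)
    qed
    \<comment> \<open>The new distance to K is bounded by the distance to the old closest point,
      which turns it into a square that can be expanded.\<close>
    have "norm (z (Suc i) - ?P (z (Suc i))) \<le> norm (z (Suc i) - ?P (z i))"
      using closest_point_le[OF K(1) P, of "z (Suc i)"] by (simp add: dist_norm)
    then have "(norm (z (Suc i) - ?P (z (Suc i))))\<^sup>2 \<le> (norm (?n + h *\<^sub>R ?v))\<^sup>2"
      by (intro power_mono) (auto simp: z(2) algebra_simps)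
    also have "\<dots> = (norm ?n)\<^sup>2 + 2 * h * (?v \<bullet> ?n) + h\<^sup>2 * (norm ?v)\<^sup>2"
    proof -
      have "(norm (n + h *\<^sub>R v))\<^sup>2 = (norm n)\<^sup>2 + 2 * h * (v \<bullet> n) + h\<^sup>2 * (norm v)\<^sup>2" for n v :: 'a
        unfolding power2_norm_eq_inner
        by (simp add: inner_add_left inner_add_right inner_commute power2_eq_square algebra_simps)
      then show ?thesis .
    qed
    also have "\<dots> \<le> real i * (h\<^sup>2 * (M\<^sup>2 + 2)) + 2 * h * h + h\<^sup>2 * M\<^sup>2"
      using Suc.IH v h by (intro add_mono mult_left_mono) auto
    also have "\<dots> = real (Suc i) * (h\<^sup>2 * (M\<^sup>2 + 2))" by (simp add: power2_eq_square algebra_simps)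
    finally show ?case .
  qed
  moreover have "if ?P (z i) \<in> Stop then w (z i) = 0 else w (z i) \<in> F (?P (z i))" for i
    using w[of "z i"] by auto
  ultimately show ?thesis using that[of z "\<lambda>i. w (z i)"] z by blast
qed

section \<open>Euler polygons and their uniform limits\<close>

text \<open>For nonnegative \<tau> and h the weight of \<open>V i\<close> is the length of the part
  of [i * h, (i + 1) * h] lying before \<tau>: this is the integral of a piecewise constant
  velocity. Written as a sum, its increments are linear in \<open>V\<close>.\<close>

definition polygon :: "'a::real_normed_vector \<Rightarrow> real \<Rightarrow> nat \<Rightarrow> (nat \<Rightarrow> 'a) \<Rightarrow> real \<Rightarrow> 'a" where
  "polygon z0 h N V \<tau> = z0 + (\<Sum>i<N. (min \<tau> (real (Suc i) * h) - min \<tau> (real i * h)) *\<^sub>R V i)"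

lemma polygon_weight_nonneg:
  fixes h :: real
  assumes "0 \<le> h" "\<tau> \<le> \<tau>'"
  shows "0 \<le> (min \<tau>' (real (Suc i) * h) - min \<tau>' (real i * h))
    - (min \<tau> (real (Suc i) * h) - min \<tau> (real i * h))"
proof -
  have "real i * h \<le> real (Suc i) * h" using assms(1) by (intro mult_right_mono) auto
  then show ?thesis using assms(2) by (auto simp: min_def)
qed

lemma polygon_diff:
  "polygon z0 h N V \<tau>' - polygon z0 h N V \<tau> =
   (\<Sum>i<N. ((min \<tau>' (real (Suc i) * h) - min \<tau>' (real i * h))
    - (min \<tau> (real (Suc i) * h) - min \<tau> (real i * h))) *\<^sub>R V i)"
  unfolding polygon_def by (simp add: sum_subtractf[symmetric] scaleR_diff_left)

text \<open>The weights of an increment are nonnegative and telescope to \<tau>' - \<tau>.\<close>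

lemma polygon_lipschitz:
  assumes "0 \<le> h" "0 \<le> \<tau>" "\<tau> \<le> \<tau>'" "\<tau>' \<le> real N * h" and V: "\<And>i. i < N \<Longrightarrow> norm (V i) \<le> M"
  shows "norm (polygon z0 h N V \<tau>' - polygon z0 h N V \<tau>) \<le> M * (\<tau>' - \<tau>)"
proof -
  let ?w = "\<lambda>i. (min \<tau>' (real (Suc i) * h) - min \<tau>' (real i * h))
    - (min \<tau> (real (Suc i) * h) - min \<tau> (real i * h))"
  have "norm (polygon z0 h N V \<tau>' - polygon z0 h N V \<tau>) \<le> (\<Sum>i<N. norm (?w i *\<^sub>R V i))"
    unfolding polygon_diff by (rule norm_sum)
  also have "\<dots> \<le> (\<Sum>i<N. ?w i * M)"
    using polygon_weight_nonneg[OF assms(1,3)] V by (intro sum_mono) (auto intro!: mult_left_mono)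
  also have "\<dots> = M * (\<Sum>i<N. (min \<tau>' (real (Suc i) * h) - min \<tau> (real (Suc i) * h))
      - (min \<tau>' (real i * h) - min \<tau> (real i * h)))"
    by (simp add: sum_distrib_left algebra_simps)
  also have "\<dots> = M * (\<tau>' - \<tau>)"
    using assms by (subst sum_lessThan_telescope) auto
  finally show ?thesis .
qed

lemma polygon_node:
  assumes "0 \<le> h" "z 0 = z0" "\<And>i. z (Suc i) = z i + h *\<^sub>R V i" "j \<le> N"
  shows "polygon z0 h N V (real j * h) = z j"
  using \<open>j \<le> N\<close>
proof (induction j)
  case 0
  have "min 0 (real i * h) = 0" for i using assms(1) by simp
  then show ?case by (simp add: polygon_def assms(2) del: of_nat_Suc)
next
  case (Suc j)
  have mono: "real i * h \<le> real k * h" if "i \<le> k" for i k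
    using assms(1) that by (intro mult_right_mono) auto
  let ?w = "\<lambda>i. ((min (real (Suc j) * h) (real (Suc i) * h) - min (real (Suc j) * h) (real i * h))
    - (min (real j * h) (real (Suc i) * h) - min (real j * h) (real i * h))) *\<^sub>R V i"
  have "?w i = (if i = j then h *\<^sub>R V j else 0)" for i
  proof -
    consider "i < j" | "i = j" | "i > j" by linarith
    then show ?thesis
    proof cases
      case 1
      then show ?thesis using mono[of i j] mono[of "Suc i" j] mono[of i "Suc j"] mono[of "Suc i" "Suc j"]
        by (simp add: min_absorb2 del: of_nat_Suc)
    next
      case 2
      then show ?thesis using mono[of j "Suc j"]
        by (simp add: min_absorb2 min_absorb1 del: of_nat_Suc) (simp add: algebra_simps)
    next
      case 3
      then show ?thesis using mono[of j i] mono[of j "Suc i"] mono[of "Suc j" i] mono[of "Suc j" "Suc i"]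
        by (simp add: min_absorb1 del: of_nat_Suc)
    qed
  qed
  then have "polygon z0 h N V (real (Suc j) * h) - polygon z0 h N V (real j * h) = h *\<^sub>R V j"
    unfolding polygon_diff using Suc.prems by (simp add: sum.delta)
  with Suc show ?case using assms(3) by (simp add: algebra_simps)
qed


text \<open>\<open>e\<close> is a clock: before \<open>Stop\<close> each step lowers it by at least
  the step size, while it is nonnegative on K and starts below T, so \<open>Stop\<close> is reached
  by time T. The last conclusion stands in for an inclusion of the derivative of \<gamma> in the
  closed convex hull of F: tested on a linear functional g in integrated form, it passes to uniform
  limits without differentiability.\<close>

theorem viability:
  fixes K Stop :: "'a::euclidean_space set" and F :: "'a \<Rightarrow> 'a set" and e :: 'a
  assumes K: "closed K" "z0 \<in> K" and Stop: "closed Stop" and T: "0 < T" and M: "0 \<le> M"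
    and bound: "\<And>s v. s \<in> K \<Longrightarrow> v \<in> F s \<Longrightarrow> norm v \<le> M"
    and aim: "\<And>z \<epsilon>. closest_point K z \<notin> Stop \<Longrightarrow> 0 < \<epsilon> \<Longrightarrow>
      \<exists>v\<in>F (closest_point K z). v \<bullet> (z - closest_point K z) \<le> \<epsilon>"
    and progress: "\<And>s v. s \<in> K \<Longrightarrow> v \<in> F s \<Longrightarrow> e \<bullet> v \<le> - 1" "\<And>s. s \<in> K \<Longrightarrow> 0 \<le> e \<bullet> s" "e \<bullet> z0 < T"
  obtains \<gamma> where "continuous_on {0..T} \<gamma>" "\<gamma> 0 = z0" "\<And>\<tau>. \<tau> \<in> {0..T} \<Longrightarrow> \<gamma> \<tau> \<in> K" "\<gamma> T \<in> Stop"
    "\<And>B g \<tau> \<tau>'. \<lbrakk>open B; \<And>s v. \<lbrakk>s \<in> K; s \<in> B; v \<in> F s\<rbrakk> \<Longrightarrow> g \<bullet> v \<le> 0; 0 \<le> \<tau>; \<tau> \<le> \<tau>'; \<tau>' \<le> T;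
      \<gamma> ` {\<tau>..\<tau>'} \<subseteq> B\<rbrakk> \<Longrightarrow> g \<bullet> \<gamma> \<tau>' \<le> g \<bullet> \<gamma> \<tau>"
proof -
  let ?P = "closest_point K"
  have P: "?P y \<in> K" for y using K by (intro closest_point_in_set) auto
  define h where "h k = T / real (Suc k)" for k
  have h: "0 < h k" "real (Suc k) * h k = T" for k using T by (auto simp: h_def)
  have "\<exists>z V. z 0 = z0 \<and> (\<forall>i. z (Suc i) = z i + h k *\<^sub>R V i) \<and>
      (\<forall>i. if ?P (z i) \<in> Stop then V i = 0 else V i \<in> F (?P (z i))) \<and>
      (\<forall>i. (norm (z i - ?P (z i)))\<^sup>2 \<le> real i * ((h k)\<^sup>2 * (M\<^sup>2 + 2)))" for k
    by (rule proximal_aiming_polygon[OF K h(1) bound aim]) blast+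
  then obtain z V where z: "\<And>k. z k 0 = z0" "\<And>k i. z k (Suc i) = z k i + h k *\<^sub>R V k i"
    and V: "\<And>k i. if ?P (z k i) \<in> Stop then V k i = 0 else V k i \<in> F (?P (z k i))"
    and dist: "\<And>k i. (norm (z k i - ?P (z k i)))\<^sup>2 \<le> real i * ((h k)\<^sup>2 * (M\<^sup>2 + 2))"
    by metis
  have V_le: "norm (V k i) \<le> M" for k i
    using V[of k i] bound P M by (auto split: if_splits)
  \<comment> \<open>The k + 1 steps have total length T, so one factor \<open>h k\<close> of the
    squared distance bound is absorbed into T.\<close>
  define D where "D k = sqrt (T * (h k * (M\<^sup>2 + 2)))" for k
  have dist_le: "norm (z k i - ?P (z k i)) \<le> D k" if "i \<le> Suc k" for k i
  proof -
    have "real i * ((h k)\<^sup>2 * (M\<^sup>2 + 2)) \<le> real (Suc k) * ((h k)\<^sup>2 * (M\<^sup>2 + 2))"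
      using that by (intro mult_right_mono) auto
    also have "\<dots> = (real (Suc k) * h k) * (h k * (M\<^sup>2 + 2))" by (simp add: power2_eq_square)
    finally show ?thesis unfolding D_def h(2) using dist[of k i] by (intro real_le_rsqrt) linarith
  qed
  have h_lim: "h \<longlonglongrightarrow> 0"
    unfolding h_def using LIMSEQ_Suc[OF lim_const_over_n[of T]] .
  have "(\<lambda>k. sqrt (T * (h k * (M\<^sup>2 + 2)))) \<longlonglongrightarrow> sqrt (T * (0 * (M\<^sup>2 + 2)))"
    by (intro tendsto_intros h_lim)
  then have D_lim: "D \<longlonglongrightarrow> 0" by (simp add: D_def[abs_def])
  define p where "p k = polygon z0 (h k) (Suc k) (V k)" for k
  have p_lip: "norm (p k \<tau>' - p k \<tau>) \<le> M * \<bar>\<tau>' - \<tau>\<bar>" if "\<tau> \<in> {0..T}" "\<tau>' \<in> {0..T}" for k \<tau> \<tau>'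
  proof (cases "\<tau> \<le> \<tau>'")
    case True
    then show ?thesis using that h[of k] V_le polygon_lipschitz[of "h k" \<tau> \<tau>' "Suc k" "V k" M z0]
      by (auto simp: p_def less_imp_le simp del: of_nat_Suc)
  next
    case False
    then show ?thesis using that h[of k] V_le polygon_lipschitz[of "h k" \<tau>' \<tau> "Suc k" "V k" M z0]
      by (auto simp: p_def less_imp_le norm_minus_commute simp del: of_nat_Suc)
  qed
  have node: "p k (real i * h k) = z k i" if "i \<le> Suc k" for k i
    unfolding p_def using h(1)[of k] z that by (intro polygon_node) auto
  have node_in: "real i * h k \<in> {0..T}" if "i \<le> Suc k" for k i
  proof -
    have "real i * h k \<le> real (Suc k) * h k" using that h(1)[of k] by (intro mult_right_mono) auto
    then show ?thesis using h[of k] by (simp del: of_nat_Suc)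
  qed
  have p0: "p k 0 = z0" for k using node[of 0 k] z(1) by simp
  obtain \<gamma> r where \<gamma>: "continuous_on {0..T} \<gamma>" "strict_mono (r :: nat \<Rightarrow> nat)"
    and conv: "\<And>\<epsilon>. 0 < \<epsilon> \<Longrightarrow> \<exists>N. \<forall>n \<tau>. n \<ge> N \<and> \<tau> \<in> {0..T} \<longrightarrow> norm (p (r n) \<tau> - \<gamma> \<tau>) < \<epsilon>"
  proof (rule Arzela_Ascoli[of "{0..T}" p "norm z0 + M * T"])
    show "norm (p n \<tau>) \<le> norm z0 + M * T" if "\<tau> \<in> {0..T}" for n \<tau>
    proof -
      have "norm (p n \<tau>) \<le> norm z0 + norm (p n \<tau> - z0)" by (rule norm_triangle_sub)
      also have "norm (p n \<tau> - z0) \<le> M * \<tau>"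
        using p_lip[of 0 \<tau> n] that by (simp add: p0)
      also have "M * \<tau> \<le> M * T" using that M by (intro mult_left_mono) auto
      finally show ?thesis by simp
    qed
    show "\<exists>d>0. \<forall>n y. y \<in> {0..T} \<and> norm (x - y) < d \<longrightarrow> norm (p n x - p n y) < \<epsilon>"
      if x: "x \<in> {0..T}" and "0 < \<epsilon>" for x \<epsilon>
    proof (intro exI[of _ "\<epsilon> / (M + 1)"] conjI allI impI)
      show "0 < \<epsilon> / (M + 1)" using \<open>0 < \<epsilon>\<close> M by simp
      fix n y assume y: "y \<in> {0..T} \<and> norm (x - y) < \<epsilon> / (M + 1)"
      have "norm (p n x - p n y) \<le> M * \<bar>x - y\<bar>" using p_lip x y by blast
      also have "\<dots> \<le> (M + 1) * \<bar>x - y\<bar>" by (intro mult_right_mono) auto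
      also have "\<dots> < \<epsilon>" using y M by (simp add: field_simps)
      finally show "norm (p n x - p n y) < \<epsilon>" .
    qed
  qed auto
  have r_ge: "\<exists>N. \<forall>n\<ge>N. f (r n) < \<epsilon>" if "f \<longlonglongrightarrow> 0" "0 < \<epsilon>" for f :: "nat \<Rightarrow> real" and \<epsilon>
  proof -
    have "(\<lambda>n. f (r n)) \<longlonglongrightarrow> 0" using LIMSEQ_subseq_LIMSEQ[OF that(1) \<gamma>(2)] by (simp add: o_def)
    then show ?thesis using that(2) by (auto dest!: order_tendstoD(2) simp: eventually_sequentially)
  qed
  \<comment> \<open>Membership in K and the choice of directions refer to closest points, not to
    nodes. These also converge to \<gamma>: the error is at most M * h from time, D from the
    distance to K, and the uniform error of the polygons.\<close>
  have near: "\<exists>N. \<forall>n\<ge>N. \<forall>\<tau>\<in>{0..T}. \<forall>i\<le>Suc (r n). \<bar>\<tau> - real i * h (r n)\<bar> \<le> h (r n) \<longrightarrow>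
      norm (?P (z (r n) i) - \<gamma> \<tau>) < \<epsilon>" if \<epsilon>: "0 < \<epsilon>" for \<epsilon>
  proof -
    obtain N1 where N1: "\<And>n \<tau>. n \<ge> N1 \<Longrightarrow> \<tau> \<in> {0..T} \<Longrightarrow> norm (p (r n) \<tau> - \<gamma> \<tau>) < \<epsilon> / 2"
      using conv[of "\<epsilon> / 2"] \<epsilon> by auto
    have "(\<lambda>k. M * h k + D k) \<longlonglongrightarrow> M * 0 + 0" by (intro tendsto_intros h_lim D_lim)
    then obtain N2 where N2: "\<And>n. n \<ge> N2 \<Longrightarrow> M * h (r n) + D (r n) < \<epsilon> / 2"
      using r_ge[of "\<lambda>k. M * h k + D k" "\<epsilon> / 2"] \<epsilon> by auto
    have "norm (?P (z (r n) i) - \<gamma> \<tau>) < \<epsilon>"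
      if n: "n \<ge> max N1 N2" and \<tau>: "\<tau> \<in> {0..T}" and i: "i \<le> Suc (r n)" "\<bar>\<tau> - real i * h (r n)\<bar> \<le> h (r n)" for n \<tau> i
    proof -
      have "norm (z (r n) i - p (r n) \<tau>) \<le> M * \<bar>real i * h (r n) - \<tau>\<bar>"
        using p_lip[OF \<tau> node_in[OF i(1)], of "r n"] unfolding node[OF i(1)] .
      also have "\<dots> \<le> M * h (r n)" using i(2) M by (intro mult_left_mono) auto
      finally have "norm (z (r n) i - p (r n) \<tau>) \<le> M * h (r n)" .
      moreover have "norm (p (r n) \<tau> - \<gamma> \<tau>) < \<epsilon> / 2" "M * h (r n) + D (r n) < \<epsilon> / 2"
        using N1 N2 n \<tau> by auto
      moreover have "norm (?P (z (r n) i) - z (r n) i) \<le> D (r n)"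
        using dist_le[OF i(1)] by (simp add: norm_minus_commute)
      moreover have "norm (?P (z (r n) i) - \<gamma> \<tau>) \<le> norm (?P (z (r n) i) - z (r n) i)
          + norm (z (r n) i - p (r n) \<tau>) + norm (p (r n) \<tau> - \<gamma> \<tau>)"
        using norm_triangle_ineq[of "?P (z (r n) i) - z (r n) i" "z (r n) i - \<gamma> \<tau>"]
          norm_triangle_ineq[of "z (r n) i - p (r n) \<tau>" "p (r n) \<tau> - \<gamma> \<tau>"] by simp
      ultimately show ?thesis by linarith
    qed
    then show ?thesis by blast
  qed
  have floor: "\<exists>i\<le>Suc k. \<bar>\<tau> - real i * h k\<bar> \<le> h k" if "\<tau> \<in> {0..T}" for k \<tau>
  proof -
    define i where "i = nat \<lfloor>\<tau> / h k\<rfloor>"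
    have "0 \<le> \<tau> / h k" using that h(1)[of k] by simp
    then have i: "real i \<le> \<tau> / h k" "\<tau> / h k < real i + 1" unfolding i_def by linarith+
    then have *: "real i * h k \<le> \<tau>" "\<tau> < real i * h k + h k"
      using h(1)[of k] by (simp_all add: field_simps)
    have "\<tau> / h k \<le> real (Suc k)" using that h[of k] by (simp add: field_simps)
    then have "i \<le> Suc k" using i(1) by linarith
    then show ?thesis using * by (intro exI[of _ i]) auto
  qed
  show thesis
  proof
    show "continuous_on {0..T} \<gamma>" by fact
    show "\<gamma> 0 = z0"
    proof (rule ccontr)
      assume "\<gamma> 0 \<noteq> z0"
      then have "0 < norm (z0 - \<gamma> 0)" by simp
      from conv[OF this] obtain N
        where "\<forall>n \<tau>. N \<le> n \<and> \<tau> \<in> {0..T} \<longrightarrow> norm (p (r n) \<tau> - \<gamma> \<tau>) < norm (z0 - \<gamma> 0)" ..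
      from this[rule_format, of N 0] show False using T by (simp add: p0)
    qed
    show "\<gamma> \<tau> \<in> K" if "\<tau> \<in> {0..T}" for \<tau>
    proof -
      have "\<exists>y\<in>K. dist y (\<gamma> \<tau>) < \<epsilon>" if "0 < \<epsilon>" for \<epsilon>
        using near[OF that] floor[OF \<open>\<tau> \<in> {0..T}\<close>] \<open>\<tau> \<in> {0..T}\<close> P unfolding dist_norm by (metis order_refl)
      then show ?thesis using closed_approachable[OF \<open>closed K\<close>] by blast
    qed
    show "\<gamma> T \<in> Stop"
    proof -
      have "(\<lambda>k. norm e * D k) \<longlonglongrightarrow> norm e * 0" by (intro tendsto_intros D_lim)
      then obtain N1 where N1: "\<And>n. n \<ge> N1 \<Longrightarrow> norm e * D (r n) < T - e \<bullet> z0"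
        using r_ge[of "\<lambda>k. norm e * D k" "T - e \<bullet> z0"] progress(3) by auto
      \<comment> \<open>A polygon whose closest point enters \<open>Stop\<close> is frozen, so
        missing \<open>Stop\<close> at the end means never having met it. The clock would then have
        fallen by T, below the lower bound - norm e * D that the nearby point of K imposes.\<close>
      have stop: "?P (z (r n) (Suc (r n))) \<in> Stop" if n: "n \<ge> N1" for n
      proof (rule ccontr)
        assume contr: "?P (z (r n) (Suc (r n))) \<notin> Stop"
        let ?k = "r n"
        have frozen: "z ?k (i + j) = z ?k i" if "?P (z ?k i) \<in> Stop" for i j
          using that by (induction j) (use z(2) V in \<open>auto split: if_splits\<close>)
        have run: "?P (z ?k i) \<notin> Stop" if "i \<le> Suc ?k" for i
          using frozen[of i "Suc ?k - i"] contr that by auto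
        have "e \<bullet> z ?k i \<le> e \<bullet> z0 - real i * h ?k" if "i \<le> Suc ?k" for i
          using that
        proof (induction i)
          case (Suc i)
          have "e \<bullet> V ?k i \<le> - 1" using V[of ?k i] run[of i] Suc.prems progress(1) P by auto
          then have "h ?k * (e \<bullet> V ?k i) \<le> h ?k * (- 1)" using h(1)[of ?k] by (intro mult_left_mono) auto
          then show ?case using Suc by (simp add: z(2) inner_add_right algebra_simps)
        qed (simp add: z)
        from this[of "Suc ?k"] have "e \<bullet> z ?k (Suc ?k) \<le> e \<bullet> z0 - T" using h(2)[of ?k] by simp
        moreover have "0 \<le> e \<bullet> ?P (z ?k (Suc ?k))" by (intro progress P)
        moreover have "e \<bullet> (?P (z ?k (Suc ?k)) - z ?k (Suc ?k)) \<le> norm e * D ?k"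
        proof -
          have "e \<bullet> (?P (z ?k (Suc ?k)) - z ?k (Suc ?k)) \<le> norm e * norm (?P (z ?k (Suc ?k)) - z ?k (Suc ?k))"
            by (rule norm_cauchy_schwarz)
          also have "\<dots> \<le> norm e * D ?k"
            using dist_le[of "Suc ?k" ?k] by (intro mult_left_mono) (auto simp: norm_minus_commute)
          finally show ?thesis .
        qed
        ultimately show False using N1[OF n] by (simp add: inner_diff_right)
      qed
      have "\<exists>y\<in>Stop. dist y (\<gamma> T) < \<epsilon>" if \<epsilon>: "0 < \<epsilon>" for \<epsilon>
      proof -
        obtain N where N: "\<forall>n\<ge>N. \<forall>\<tau>\<in>{0..T}. \<forall>i\<le>Suc (r n). \<bar>\<tau> - real i * h (r n)\<bar> \<le> h (r n) \<longrightarrow>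
          norm (?P (z (r n) i) - \<gamma> \<tau>) < \<epsilon>" using near[OF \<epsilon>] by blast
        let ?n = "max N N1"
        have "norm (?P (z (r ?n) (Suc (r ?n))) - \<gamma> T) < \<epsilon>"
          using N[rule_format, of ?n T "Suc (r ?n)"] h[of "r ?n"] T by (simp del: of_nat_Suc)
        then show ?thesis using stop[of ?n] by (auto simp: dist_norm)
      qed
      then show ?thesis using closed_approachable[OF \<open>closed Stop\<close>] by blast
    qed
    fix B g \<tau> \<tau>'
    assume "open B" and g: "\<And>s v. \<lbrakk>s \<in> K; s \<in> B; v \<in> F s\<rbrakk> \<Longrightarrow> g \<bullet> v \<le> 0"
      and \<tau>: "0 \<le> \<tau>" "\<tau> \<le> \<tau>'" "\<tau>' \<le> T" and B: "\<gamma> ` {\<tau>..\<tau>'} \<subseteq> B"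
    have "compact (\<gamma> ` {\<tau>..\<tau>'})"
      using \<tau> by (intro compact_continuous_image continuous_on_subset[OF \<gamma>(1)]) auto
    then obtain \<delta> where \<delta>: "0 < \<delta>" "(\<Union>x\<in>\<gamma> ` {\<tau>..\<tau>'}. ball x \<delta>) \<subseteq> B"
      by (rule compact_subset_open_imp_ball_epsilon_subset[OF _ \<open>open B\<close> B])
    obtain N where N: "\<forall>n\<ge>N. \<forall>\<tau>\<in>{0..T}. \<forall>i\<le>Suc (r n). \<bar>\<tau> - real i * h (r n)\<bar> \<le> h (r n) \<longrightarrow>
      norm (?P (z (r n) i) - \<gamma> \<tau>) < \<delta>" using near[OF \<delta>(1)] by blast
    have "g \<bullet> (p (r n) \<tau>' - p (r n) \<tau>) \<le> 0" if n: "n \<ge> N" for n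
    proof -
      let ?k = "r n"
      have "w * (g \<bullet> V ?k i) \<le> 0"
        if "i < Suc ?k" and w_def: "w = (min \<tau>' (real (Suc i) * h ?k) - min \<tau>' (real i * h ?k))
          - (min \<tau> (real (Suc i) * h ?k) - min \<tau> (real i * h ?k))" for i w
      proof (cases "real i * h ?k < \<tau>' \<and> \<tau> < real (Suc i) * h ?k")
        case True
        have w: "0 \<le> w" unfolding w_def using h(1)[of ?k] \<tau>(2) by (intro polygon_weight_nonneg) auto
        \<comment> \<open>A time in [\<tau>, \<tau>'] within one step of node i: there \<gamma> is
          in B with room \<delta>, so the closest point of the node is in B too. Steps without such
          a time have weight 0.\<close>
        define \<sigma> where "\<sigma> = max \<tau> (real i * h ?k)"
        have \<sigma>: "\<sigma> \<in> {\<tau>..\<tau>'}" "\<bar>\<sigma> - real i * h ?k\<bar> \<le> h ?k"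
          using True \<tau> h(1)[of ?k] by (auto simp: \<sigma>_def algebra_simps)
        then have "norm (?P (z ?k i) - \<gamma> \<sigma>) < \<delta>" using N n \<tau> that(1) by auto
        then have "?P (z ?k i) \<in> B" using \<delta>(2) \<sigma>(1) by (force simp: dist_norm norm_minus_commute)
        then have "g \<bullet> V ?k i \<le> 0" using g[OF P, of "z ?k i" "V ?k i"] V[of ?k i] by (auto split: if_splits)
        then show ?thesis using w by (rule mult_nonneg_nonpos[rotated])
      next
        case False
        have "real i * h ?k \<le> real (Suc i) * h ?k" using h(1)[of ?k] by (intro mult_right_mono) auto
        with False have "w = 0" using \<tau>(2) unfolding w_def by (auto simp: min_def not_less)
        then show ?thesis by simp
      qed
      then show ?thesis unfolding p_def polygon_diff inner_sum_right inner_scaleR_right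
        by (intro sum_nonpos) auto
    qed
    moreover have "(\<lambda>n. g \<bullet> (p (r n) \<tau>' - p (r n) \<tau>)) \<longlonglongrightarrow> g \<bullet> (\<gamma> \<tau>' - \<gamma> \<tau>)"
    proof -
      have "(\<lambda>n. p (r n) \<sigma>) \<longlonglongrightarrow> \<gamma> \<sigma>" if "\<sigma> \<in> {0..T}" for \<sigma>
        unfolding LIMSEQ_iff using conv that by blast
      then show ?thesis using \<tau> by (intro tendsto_intros) auto
    qed
    ultimately have "g \<bullet> (\<gamma> \<tau>' - \<gamma> \<tau>) \<le> 0" by (intro LIMSEQ_le_const2) auto
    then show "g \<bullet> \<gamma> \<tau>' \<le> g \<bullet> \<gamma> \<tau>" by (simp add: inner_diff_right)
  qed
qed

section \<open>Proximal normals to epigraphs\<close>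

text \<open>Real heights keep the set inside a Euclidean space, where closest points exist; S
  discards the arbitrary values of f elsewhere.\<close>

definition ereal_epigraph :: "'a set \<Rightarrow> ('a \<Rightarrow> ereal) \<Rightarrow> ('a \<times> real) set" where
  "ereal_epigraph S f = {(z, w). z \<in> S \<and> f z \<le> ereal w}"

lemma closed_epigraph:
  fixes f :: "'a::metric_space \<Rightarrow> ereal"
  assumes "closed S" "lower_semicontinuous_on S f"
  shows "closed (ereal_epigraph S f)"
  unfolding closed_sequential_limits
proof (intro allI impI, elim conjE)
  fix k l assume k: "\<forall>n. k n \<in> ereal_epigraph S f" and lim: "k \<longlonglongrightarrow> l"
  obtain z w where l: "l = (z, w)" by (cases l)
  have z: "(\<lambda>n. fst (k n)) \<longlonglongrightarrow> z" and w: "(\<lambda>n. snd (k n)) \<longlonglongrightarrow> w"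
    using tendsto_fst[OF lim] tendsto_snd[OF lim] by (simp_all add: l)
  have kS: "fst (k n) \<in> S" "f (fst (k n)) \<le> ereal (snd (k n))" for n
    using k by (auto simp: ereal_epigraph_def split_beta)
  have "z \<in> S" using closed_sequentially[OF \<open>closed S\<close> _ z] kS by blast
  moreover have "f z \<le> ereal w"
  proof (rule ccontr)
    assume "\<not> ?thesis"
    then obtain c where c: "ereal w < ereal c" "ereal c < f z" by (meson ereal_dense2 not_le)
    have "\<forall>\<^sub>F z' in at z within S. ereal c < f z'"
      using assms(2) \<open>z \<in> S\<close> c(2) by (auto simp: lower_semicontinuous_on_def)
    \<comment> \<open>The sequence may take the value z itself, so the punctured neighbourhood is
      completed using c < f z.\<close>
    then have "\<forall>\<^sub>F z' in nhds z. z' \<in> S \<longrightarrow> ereal c < f z'"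
      unfolding eventually_at_filter by (rule eventually_mono) (use c(2) in auto)
    then have "\<forall>\<^sub>F n in sequentially. ereal c < f (fst (k n))"
      using z kS(1) by (auto dest: filterlim_iff[THEN iffD1, rule_format])
    moreover have "\<forall>\<^sub>F n in sequentially. snd (k n) < c"
      using w c(1) by (auto intro: order_tendstoD)
    ultimately have "\<forall>\<^sub>F n in sequentially. False"
    proof eventually_elim
      case (elim n)
      then show ?case using kS(2)[of n] by (meson ereal_less_eq(3) le_less_trans less_le_trans not_less order.strict_trans1 less_ereal.simps(1) order.asym)
    qed
    then show False by simp
  qed
  ultimately show "l \<in> ereal_epigraph S f" by (simp add: l ereal_epigraph_def)
qed

text \<open>Expansion of |n|^2 \<le> |n - (k - P y)|^2 with n = y - P y. The quadratic error is the
  defect from convexity of K and is the proximal normal inequality used below.\<close>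

lemma closest_point_normal:
  fixes K :: "'a::euclidean_space set"
  assumes "closed K" "k \<in> K"
  shows "2 * ((y - closest_point K y) \<bullet> (k - closest_point K y)) \<le> (norm (k - closest_point K y))\<^sup>2"
proof -
  have "norm (y - closest_point K y) \<le> norm (y - k)"
    using closest_point_le[OF assms] by (simp add: dist_norm)
  then have "(norm (y - closest_point K y))\<^sup>2 \<le> (norm ((y - closest_point K y) - (k - closest_point K y)))\<^sup>2"
    by (intro power_mono) auto
  also have "\<dots> = (norm (y - closest_point K y))\<^sup>2 - 2 * ((y - closest_point K y) \<bullet> (k - closest_point K y))
      + (norm (k - closest_point K y))\<^sup>2"
    by (simp only: power2_norm_eq_inner inner_diff inner_commute) (simp add: algebra_simps inner_commute)
  finally show ?thesis by simp
qed

context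
  fixes S :: "'a::euclidean_space set" and f :: "'a \<Rightarrow> ereal" and z p :: 'a and w q :: real
  assumes mem: "(z, w) \<in> ereal_epigraph S f"
    and normal: "\<And>z' w'. (z', w') \<in> ereal_epigraph S f \<Longrightarrow>
      2 * (p \<bullet> (z' - z) - q * (w' - w)) \<le> (norm (z' - z))\<^sup>2 + (w' - w)\<^sup>2"
begin

lemma epigraph_normal_nonneg: "0 \<le> q"
proof (rule ccontr)
  assume q: "\<not> 0 \<le> q"
  have "(z, w - q) \<in> ereal_epigraph S f" 
    using mem q by (auto simp: ereal_epigraph_def elim!: order_trans)
  from normal[OF this] have "2 * q\<^sup>2 \<le> q\<^sup>2" by (simp add: power2_eq_square)
  then show False using q by auto
qed

text \<open>A point strictly above the graph could be lowered by some d in (0, q], giving 2 * q * d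
  \<le> d^2.\<close>

lemma epigraph_normal_value:
  assumes "0 < q" "f z \<noteq> - \<infinity>"
  shows "f z = ereal w"
proof (rule ccontr)
  assume "f z \<noteq> ereal w"
  with mem have "f z < ereal w" by (auto simp: ereal_epigraph_def)
  then obtain v where v: "f z < ereal v" "ereal v < ereal w" using ereal_dense2 by blast
  define d where "d = min (w - v) q"
  have d: "0 < d" "d \<le> q" "v \<le> w - d" using v assms by (auto simp: d_def)
  have "f z \<le> ereal (w - d)" using v(1) d(3) by (meson ereal_less_eq(3) less_imp_le order_trans)
  then have "(z, w - d) \<in> ereal_epigraph S f" using mem by (simp add: ereal_epigraph_def)
  from normal[OF this] have "2 * q * d \<le> d * d" by (simp add: power2_eq_square)
  then have "2 * q \<le> d" using d(1) by simp
  then show False using d \<open>0 < q\<close> by simp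
qed

text \<open>If f z' fell below w + r, with r = (p / q) . d - e |d| and d = z' - z, then (z', w + r)
  would be in the epigraph. Testing the normal there gives 2 q e |d| \<le> B |d|^2, which fails for
  |d| < 2 q e / B; B comes from |r| \<le> (|p / q| + e) |d|. The height w + r is used instead of f
  z', which has no lower bound of this order.\<close>

lemma epigraph_normal_subdifferential:
  assumes "0 < q" "f z \<noteq> - \<infinity>" "z \<in> interior S"
  shows "p /\<^sub>R q \<in> subdifferential f z"
proof -
  have fz: "f z = ereal w" using epigraph_normal_value[OF assms(1,2)] .
  let ?X = "\<lambda>z'. (f z' - f z - ereal ((p /\<^sub>R q) \<bullet> (z' - z))) / ereal (norm (z' - z))"
  have "\<forall>\<^sub>F z' in at z. c < ?X z'" if c: "c < 0" for c
  proof -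
    obtain e' where e': "c < ereal e'" "ereal e' < 0" using ereal_dense2[OF c] by blast
    define e where "e = - e'"
    have e: "e > 0" "c < ereal (- e)" using e' by (auto simp: e_def)
    define B where "B = 1 + (norm (p /\<^sub>R q) + e)\<^sup>2"
    have B: "B > 0" by (simp add: B_def add_pos_nonneg)
    have "\<forall>\<^sub>F z' in at z. z' \<in> S \<and> z' \<noteq> z \<and> dist z' z < 2 * q * e / B"
    proof (intro eventually_conj)
      show "\<forall>\<^sub>F z' in at z. z' \<in> S"
        using assms(3) eventually_nhds_in_open[of "interior S" z] interior_subset[of S]
        by (auto simp: eventually_at_filter elim!: eventually_mono)
      show "\<forall>\<^sub>F z' in at z. z' \<noteq> z" by (simp add: eventually_at_filter)
      show "\<forall>\<^sub>F z' in at z. dist z' z < 2 * q * e / B"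
        unfolding eventually_at using e B \<open>0 < q\<close> by (intro exI[of _ "2 * q * e / B"]) auto
    qed
    then show ?thesis
    proof eventually_elim
      case (elim z')
      define d where "d = z' - z"
      have d: "0 < norm d" "norm d < 2 * q * e / B" using elim by (auto simp: d_def dist_norm)
      define r where "r = (p /\<^sub>R q) \<bullet> d - e * norm d"
      have "ereal (w + r) \<le> f z'"
      proof (rule ccontr)
        assume "\<not> ?thesis"
        then have "(z', w + r) \<in> ereal_epigraph S f" using elim by (simp add: ereal_epigraph_def)
        from normal[OF this] have "2 * (p \<bullet> d - q * r) \<le> (norm d)\<^sup>2 + r\<^sup>2" by (simp add: d_def)
        moreover have "p \<bullet> d - q * r = q * e * norm d" using \<open>0 < q\<close> by (simp add: r_def field_simps)
        moreover have "\<bar>r\<bar> \<le> (norm (p /\<^sub>R q) + e) * norm d"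
        proof -
          have "0 \<le> e * norm d" using e(1) by simp
          then show ?thesis using Cauchy_Schwarz_ineq2[of "p /\<^sub>R q" d]
            unfolding r_def distrib_right by linarith
        qed
        then have "r\<^sup>2 \<le> (norm (p /\<^sub>R q) + e)\<^sup>2 * (norm d)\<^sup>2"
          unfolding power_mult_distrib[symmetric] by (rule abs_le_square_iff[THEN iffD1, OF order_trans]) simp
        ultimately have "2 * (q * e * norm d) \<le> B * (norm d)\<^sup>2"
          by (simp only: B_def distrib_right mult_1)
        then have "(2 * q * e) * norm d \<le> (B * norm d) * norm d" by (simp add: power2_eq_square mult.assoc)
        then have "2 * q * e \<le> B * norm d" using d(1) by simp
        then show False using d(2) B by (simp add: field_simps)
      qed
      then have "ereal (- e) \<le> ?X z'"
        unfolding fz d_def[symmetric]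
        using d(1) by (cases "f z'") (auto simp: r_def field_simps ereal_divide)
      then show ?case using e(2) by simp
    qed
  qed
  then show ?thesis
    by (simp add: subdifferential_def finite_dom_def fz le_Liminf_iff)
qed

end

section \<open>Horizontal normals and the aiming condition\<close>

lemma contingent_derivative_less_frequently:
  assumes "contingent_derivative W z v < \<infinity>"
  shows "\<exists>c. \<forall>P Q. (\<forall>\<^sub>F h in at_right 0. P h) \<longrightarrow> (\<forall>\<^sub>F v' in nhds v. Q v') \<longrightarrow>
    (\<exists>h v'. P h \<and> Q v' \<and> (W (z + h *\<^sub>R v') - W z) / ereal h < ereal c)"
proof -
  obtain c where c: "contingent_derivative W z v < ereal c"
    using assms ereal_dense2 by blast
  show ?thesis
  proof (rule exI[of _ c], intro allI impI, rule ccontr)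
    fix P Q
    assume P: "\<forall>\<^sub>F h in at_right 0. P h" and Q: "\<forall>\<^sub>F v' in nhds v. Q v'"
      and no: "\<nexists>h v'. P h \<and> Q v' \<and> (W (z + h *\<^sub>R v') - W z) / ereal h < ereal c"
    have "\<forall>\<^sub>F (h, v') in at_right 0 \<times>\<^sub>F nhds v. ereal c \<le> (W (z + h *\<^sub>R v') - W z) / ereal h"
      using P Q no unfolding eventually_prod_filter by (force simp: not_less)
    then have "ereal c \<le> contingent_derivative W z v"
      unfolding contingent_derivative_def by (intro Liminf_bounded) (simp add: case_prod_unfold)
    with c show False by simp
  qed
qed

text \<open>The case of a normal with only a time component. The finite contingent derivative
  supplies points of the epigraph at z + h v with v near (-1, u) and height at most w + h |c|. If pt
  < 0, the left side of the normal inequality is at least h * (- pt), of first order, while the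
  right side is of order h^2.\<close>

lemma epigraph_normal_time_nonneg:
  fixes W :: "real \<times> 'a::euclidean_space \<Rightarrow> ereal"
  assumes mem: "((t, x), w) \<in> ereal_epigraph S W" and "(t, x) \<in> interior S"
    and normal: "\<And>z' w'. (z', w') \<in> ereal_epigraph S W \<Longrightarrow>
      2 * (pt * (fst z' - t)) \<le> (norm (z' - (t, x)))\<^sup>2 + (w' - w)\<^sup>2"
    and W: "\<And>z. z \<in> S \<Longrightarrow> 0 \<le> W z"
    and deriv: "contingent_derivative W (t, x) (-1, u) < \<infinity>"
  shows "0 \<le> pt"
proof (rule ccontr)
  assume "\<not> 0 \<le> pt"
  then have pt: "pt < 0" by simp
  let ?z = "(t, x)" and ?v = "(- 1 :: real, u)"
  have zS: "?z \<in> S" using assms(2) interior_subset by blast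
  obtain a where a: "W ?z = ereal a" "a \<le> w"
    using mem W[OF zS] by (cases "W ?z") (auto simp: ereal_epigraph_def)
  obtain c where c: "\<And>P Q. (\<forall>\<^sub>F h in at_right 0. P h) \<Longrightarrow> (\<forall>\<^sub>F v' in nhds ?v. Q v') \<Longrightarrow>
    \<exists>h v'. P h \<and> Q v' \<and> (W (?z + h *\<^sub>R v') - W ?z) / ereal h < ereal c"
    using contingent_derivative_less_frequently[OF deriv] by blast
  obtain r where r: "r > 0" "ball ?z r \<subseteq> S" using assms(2) by (auto simp: mem_interior)
  define R where "R = norm ?v + 1"
  have R: "R > 0" by (simp add: R_def add_nonneg_pos)
  \<comment> \<open>The first bound keeps z + h v in the ball inside S, the second makes h * (R^2 +
    c^2) smaller than - pt.\<close>
  define d where "d = min (r / R) (- pt / (R\<^sup>2 + c\<^sup>2))"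
  have Rc: "0 < R\<^sup>2 + c\<^sup>2" using R by (intro add_pos_nonneg) auto
  then have d: "d > 0" using r R pt by (auto simp: d_def divide_neg_pos)
  have "\<forall>\<^sub>F h in at_right 0. 0 < h \<and> h < d"
    using d by (auto simp: eventually_at_right)
  moreover have "\<forall>\<^sub>F v' in nhds ?v. dist v' ?v < 1 / 2"
    unfolding eventually_nhds_metric by (intro exI[of _ "1 / 2"]) auto
  ultimately obtain h v where h: "0 < h" "h < d" and v: "dist v ?v < 1 / 2"
    and less: "(W (?z + h *\<^sub>R v) - W ?z) / ereal h < ereal c"
    using c by blast
  have "norm v \<le> norm ?v + norm (v - ?v)" by (rule norm_triangle_sub)
  also have "norm (v - ?v) \<le> 1" using v by (simp add: dist_norm)
  finally have "norm v \<le> R" by (simp add: R_def)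
  have vt: "fst v \<le> - 1 / 2" using v dist_fst_le[of v ?v] by (auto simp: dist_real_def)
  have "norm (h *\<^sub>R v) < r"
  proof -
    have "norm (h *\<^sub>R v) \<le> h * R" using \<open>norm v \<le> R\<close> h by (auto intro!: mult_left_mono)
    also have "\<dots> < d * R" using h R by simp
    also have "\<dots> \<le> r / R * R" using R by (intro mult_right_mono) (auto simp: d_def)
    finally show ?thesis using R by simp
  qed
  then have S: "?z + h *\<^sub>R v \<in> S" using r(2) by (auto simp: dist_norm)
  have "W (?z + h *\<^sub>R v) \<le> ereal (a + h * c)"
    using less W[OF S] h(1) unfolding a(1)
    by (cases "W (?z + h *\<^sub>R v)") (auto simp: field_simps)
  also have "\<dots> \<le> ereal (w + h * \<bar>c\<bar>)" using a(2) h(1) by (auto intro!: add_mono mult_left_mono)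
  finally have "(?z + h *\<^sub>R v, w + h * \<bar>c\<bar>) \<in> ereal_epigraph S W" using S by (simp add: ereal_epigraph_def)
  from normal[OF this] have "2 * (pt * (h * fst v)) \<le> h\<^sup>2 * (norm v)\<^sup>2 + h\<^sup>2 * c\<^sup>2"
    by (simp add: power_mult_distrib)
  then have "h * (2 * (pt * fst v)) \<le> h * (h * ((norm v)\<^sup>2 + c\<^sup>2))" by (simp add: power2_eq_square algebra_simps)
  then have "2 * (pt * fst v) \<le> h * ((norm v)\<^sup>2 + c\<^sup>2)" using h(1) by simp
  also have "\<dots> \<le> h * (R\<^sup>2 + c\<^sup>2)" using h(1) \<open>norm v \<le> R\<close> by (auto intro!: mult_left_mono power_mono)
  also have "\<dots> < - pt"
  proof -
    have "h < - pt / (R\<^sup>2 + c\<^sup>2)" using h(2) by (simp add: d_def)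
    then show ?thesis using Rc by (simp add: field_simps)
  qed
  finally have "2 * (pt * fst v) < - pt" .
  moreover have "pt * (- 1 / 2) \<le> pt * fst v" using vt pt by (intro mult_left_mono_neg) auto
  ultimately show False by simp
qed

text \<open>The extended direction \<open>(-1, u, -L(x, u))\<close>, normalized so that time and cost together
  decrease at unit rate; by superlinearity of \<open>L\<close> all these directions are bounded.\<close>

definition direction :: "('a::real_normed_vector \<Rightarrow> 'a \<Rightarrow> real) \<Rightarrow> 'a \<Rightarrow> 'a \<Rightarrow> (real \<times> 'a) \<times> real" where
  "direction L x u = (1 / (1 + L x u)) *\<^sub>R ((- 1, u), - L x u)"

text \<open>After clearing the denominator 1 + L \<ge> 1, the condition on u is - pt + px . u + q *
  L x u \<le> \<epsilon>. The tolerance \<epsilon> is there because the supremum in the Hamiltonian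
  is only approximated.\<close>

lemma epigraph_aiming:
  fixes W :: "real \<times> 'a::euclidean_space \<Rightarrow> ereal" and L :: "'a \<Rightarrow> 'a \<Rightarrow> real"
  assumes L: "\<And>x u. 0 \<le> L x u" and W: "\<And>z. z \<in> S \<Longrightarrow> 0 \<le> W z"
    and K: "closed (ereal_epigraph S W)" "ereal_epigraph S W \<noteq> {}"
    and s: "closest_point (ereal_epigraph S W) y = ((t, x), w)" and int: "(t, x) \<in> interior S"
    and deriv: "(t, x) \<in> finite_dom W \<Longrightarrow> contingent_derivative W (t, x) (-1, u0) < \<infinity>"
    and super: "\<And>pt px. (pt, px) \<in> subdifferential W (t, x) \<Longrightarrow> 0 \<le> ereal pt + hamiltonian L x (- px)"
    and "0 < \<epsilon>"
  shows "\<exists>u. direction L x u \<bullet> (y - ((t, x), w)) \<le> \<epsilon>"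
proof -
  let ?K = "ereal_epigraph S W"
  define pt px q where "pt = fst (fst y) - t" and "px = snd (fst y) - x" and "q = w - snd y"
  have n: "y - ((t, x), w) = ((pt, px), - q)"
    by (cases y) (auto simp: pt_def px_def q_def prod_eq_iff)
  have mem: "((t, x), w) \<in> ?K" using closest_point_in_set[OF K, of y] by (simp add: s)
  have normal: "2 * ((pt, px) \<bullet> (z' - (t, x)) - q * (w' - w)) \<le> (norm (z' - (t, x)))\<^sup>2 + (w' - w)\<^sup>2"
    if "(z', w') \<in> ?K" for z' w'
    using closest_point_normal[OF K(1) that, of y] unfolding s n
    by (simp add: norm_Pair inner_Pair)
  have zS: "(t, x) \<in> S" using int interior_subset by blast
  have fin: "(t, x) \<in> finite_dom W" using mem W[OF zS] by (auto simp: ereal_epigraph_def finite_dom_def)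
  have suff: ?thesis if "- pt + px \<bullet> u + q * L x u \<le> \<epsilon>" for u
  proof -
    have "direction L x u \<bullet> (y - ((t, x), w)) = (- pt + px \<bullet> u + q * L x u) / (1 + L x u)"
      unfolding n direction_def by (simp add: inner_Pair inner_commute diff_divide_distrib add_divide_distrib)
    also have "\<dots> \<le> \<epsilon> / (1 + L x u)" using that L[of x u] by (intro divide_right_mono) auto
    also have "\<dots> \<le> \<epsilon>" using L[of x u] \<open>0 < \<epsilon>\<close> by (simp add: field_simps)
    finally show ?thesis by blast
  qed
  have "0 \<le> q" using epigraph_normal_nonneg[OF mem normal] .
  consider "q > 0" | "q = 0" "px \<noteq> 0" | "q = 0" "px = 0" using \<open>0 \<le> q\<close> by fastforce
  then show ?thesis
  proof cases
    case 1
    have "(pt, px) /\<^sub>R q \<in> subdifferential W (t, x)"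
      using epigraph_normal_subdifferential[OF mem normal 1 _ int] W[OF zS] by auto
    then have H: "0 \<le> ereal (pt / q) + hamiltonian L x (- (px /\<^sub>R q))"
      using super[of "pt / q" "px /\<^sub>R q"] by (simp add: divide_inverse mult.commute)
    \<comment> \<open>Room \<epsilon> / q below the supremum becomes \<epsilon> after multiplication
      by q.\<close>
    have "ereal (- pt / q - \<epsilon> / q) < hamiltonian L x (- (px /\<^sub>R q))"
      using H divide_pos_pos[OF \<open>0 < \<epsilon>\<close> 1] by (cases "hamiltonian L x (- (px /\<^sub>R q))") auto
    then obtain u where "- pt / q - \<epsilon> / q < - (px /\<^sub>R q) \<bullet> u - L x u"
      unfolding hamiltonian_def by (auto simp: less_SUP_iff)
    then have "q * (- pt / q - \<epsilon> / q) \<le> q * (- (px /\<^sub>R q) \<bullet> u - L x u)" using 1 by (intro mult_left_mono) auto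
    then have "- pt + px \<bullet> u + q * L x u \<le> \<epsilon>" using 1 by (simp add: right_diff_distrib mult.assoc[symmetric])
    then show ?thesis by (rule suff)
  next
    case 2
    define u where "u = (- \<bar>pt\<bar> / (px \<bullet> px)) *\<^sub>R px"
    \<comment> \<open>The cost has weight \<open>q = 0\<close>, so a sufficiently fast move against \<open>px\<close> is admissible.\<close>
    have "px \<bullet> u = - \<bar>pt\<bar>" using 2 by (simp add: u_def)
    then show ?thesis using 2 \<open>0 < \<epsilon>\<close> by (intro suff[of u]) auto
  next
    case 3
    have "0 \<le> pt"
    proof (rule epigraph_normal_time_nonneg[OF mem int _ W deriv[OF fin]])
      show "2 * (pt * (fst z' - t)) \<le> (norm (z' - (t, x)))\<^sup>2 + (w' - w)\<^sup>2" if "(z', w') \<in> ?K" for z' w'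
        using normal[OF that] 3 by (cases z') (simp add: inner_Pair)
    qed
    then show ?thesis using 3 \<open>0 < \<epsilon>\<close> by (intro suff[of 0]) auto
  qed
qed

section \<open>Running cost of limit curves\<close>

text \<open>The point (u0, f u0 - e) is separated from the closed epigraph. Comparison with (u0, f
  u0) gives q * e > 0, so the hyperplane is not vertical and can be solved for the height.\<close>

lemma convex_affine_minorant:
  fixes f :: "'a::euclidean_space \<Rightarrow> real"
  assumes "convex_on UNIV f" "0 < e"
  shows "\<exists>a p. (\<forall>u. a + p \<bullet> u \<le> f u) \<and> f u0 - e < a + p \<bullet> u0"
proof -
  have "continuous_on UNIV f" using assms(1) convex_on_continuous by blast
  let ?E = "epigraph UNIV f"
  have conv: "convex ?E" using assms(1) by (simp add: convex_epigraph)
  have "?E = {z. f (fst z) \<le> snd z}" by (auto simp: epigraph_def)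
  moreover have "continuous_on UNIV (\<lambda>z :: 'a \<times> real. f (fst z))"
    by (rule continuous_on_compose2[OF \<open>continuous_on UNIV f\<close> continuous_on_fst[OF continuous_on_id]]) simp
  ultimately have clos: "closed ?E"
    using closed_Collect_le[OF _ continuous_on_snd[OF continuous_on_id]] by metis
  have "(u0, f u0 - e) \<notin> ?E" using \<open>0 < e\<close> by (simp add: epigraph_def)
  then obtain g b where g: "g \<bullet> (u0, f u0 - e) < b" "\<And>z. z \<in> ?E \<Longrightarrow> b < g \<bullet> z"
    using separating_hyperplane_closed_point[OF conv clos] by blast
  obtain p q where pq: "g = (p, q)" by (cases g)
  have 1: "p \<bullet> u0 + q * (f u0 - e) < b" using g(1) by (simp add: pq inner_Pair)
  have 2: "b < p \<bullet> u + q * f u" for u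
    using g(2)[of "(u, f u)"] by (simp add: pq inner_Pair epigraph_def)
  have "0 < q * e" using 1 2[of u0] by (simp add: right_diff_distrib)
  then have q: "q > 0" using \<open>0 < e\<close> by (simp add: zero_less_mult_iff)
  show ?thesis
  proof (rule exI[of _ "b / q"], rule exI[of _ "- (p /\<^sub>R q)"], intro conjI allI)
    show "b / q + - (p /\<^sub>R q) \<bullet> u \<le> f u" for u
      using 2[of u] q by (simp add: field_simps)
    show "f u0 - e < b / q + - (p /\<^sub>R q) \<bullet> u0"
      using 1 q by (simp add: field_simps)
  qed
qed

lemma superlinear_ge:
  fixes \<Theta> :: "'a::euclidean_space \<Rightarrow> real"
  assumes "\<And>u. 0 \<le> \<Theta> u" "filterlim (\<lambda>u. \<Theta> u / norm u) at_top at_infinity" "0 \<le> N"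
  obtains C where "0 \<le> C" "\<And>u. N * norm u - C \<le> \<Theta> u"
proof -
  have "\<forall>\<^sub>F u in at_infinity. N \<le> \<Theta> u / norm u"
    using assms(2) by (auto simp: filterlim_at_top)
  then obtain b where b: "\<And>u. b \<le> norm u \<Longrightarrow> N \<le> \<Theta> u / norm u" by (auto simp: eventually_at_infinity)
  show ?thesis
  proof (rule that[of "N * max b 0"])
    show "0 \<le> N * max b 0" using assms(3) by simp
    show "N * norm u - N * max b 0 \<le> \<Theta> u" for u
    proof (cases "max b 0 < norm u")
      case True
      then have "N * norm u \<le> \<Theta> u" using b[of u] by (simp add: field_simps)
      moreover have "0 \<le> N * max b 0" using assms(3) by simp
      ultimately show ?thesis by linarith
    next
      case False
      then have "N * norm u \<le> N * max b 0" using assms(3) by (intro mult_left_mono) auto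
      then show ?thesis using assms(1)[of u] by linarith
    qed
  qed
qed

text \<open>For bounded \<open>u\<close> lower semicontinuity and compactness give a uniform neighbourhood of \<open>x0\<close>; for
  large \<open>u\<close> superlinear growth beats every affine function.\<close>

lemma local_affine_minorant:
  fixes L :: "'a::euclidean_space \<Rightarrow> 'a \<Rightarrow> real"
  assumes lsc: "lower_semicontinuous_on UNIV (\<lambda>(x, u). L x u)"
    and conv: "convex_on UNIV (L x0)" and "0 < e"
    and growth: "\<And>N. 0 \<le> N \<Longrightarrow> \<exists>C\<ge>0. \<forall>x u. N * norm u - C \<le> L x u"
  obtains B a p where "open B" "x0 \<in> B" "\<And>x u. x \<in> B \<Longrightarrow> a + p \<bullet> u \<le> L x u" "L x0 u0 - e < a + p \<bullet> u0"
proof -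
  have e2: "0 < e / 2" using \<open>0 < e\<close> by simp
  obtain a p where "(\<forall>u. a + p \<bullet> u \<le> L x0 u) \<and> L x0 u0 - e / 2 < a + p \<bullet> u0"
    using convex_affine_minorant[OF conv e2, of u0] by (elim exE) (rule that)
  then have ap: "\<And>u. a + p \<bullet> u \<le> L x0 u" "L x0 u0 - e / 2 < a + p \<bullet> u0" by auto
  obtain C where C: "0 \<le> C" "\<And>x u. (norm p + 1) * norm u - C \<le> L x u"
    using growth[OF add_nonneg_nonneg[OF norm_ge_zero[of p] zero_le_one]] by blast
  \<comment> \<open>For norm u > R the growth bound with slope norm p + 1 exceeds norm p * norm u +
    \<bar>a\<bar>.\<close>
  define R where "R = \<bar>a\<bar> + C"
  \<comment> \<open>Lowering the minorant by e / 2 makes the inequality strict at x0; lower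
    semicontinuity makes \<open>?U\<close> open, and the tube lemma on the compact ball gives
    B.\<close>
  let ?U = "{(x, u). a - e / 2 + p \<bullet> u < L x u}"
  have "open ?U"
    unfolding open_subopen[of ?U]
  proof (intro ballI)
    fix z assume "z \<in> ?U"
    then obtain x u where z: "z = (x, u)" "a - e / 2 + p \<bullet> u < L x u" by auto
    obtain c where c: "a - e / 2 + p \<bullet> u < c" "c < L x u" using z(2) dense by blast
    have "\<forall>\<^sub>F z' in at z within UNIV. c < (\<lambda>(x, u). L x u) z'"
      using lsc c(2) unfolding lower_semicontinuous_on_def z(1) by auto
    then have "\<forall>\<^sub>F z' in nhds z. c < (\<lambda>(x, u). L x u) z'"
      unfolding eventually_at_filter by (rule eventually_mono) (use c(2) z(1) in auto)
    moreover have "\<forall>\<^sub>F z' in nhds z. a - e / 2 + p \<bullet> snd z' < c"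
    proof -
      have "((\<lambda>z'. a - e / 2 + p \<bullet> snd z') \<longlongrightarrow> a - e / 2 + p \<bullet> snd z) (nhds z)"
        by (intro tendsto_intros filterlim_ident)
      then show ?thesis using c(1) z(1) by (auto intro: order_tendstoD)
    qed
    ultimately have "\<forall>\<^sub>F z' in nhds z. z' \<in> ?U"
    proof eventually_elim
      case (elim z')
      then show ?case by (cases z') simp
    qed
    then obtain T where "open T" "z \<in> T" "\<forall>z'\<in>T. z' \<in> ?U" unfolding eventually_nhds by (elim exE conjE) (rule that)
    then show "\<exists>T. open T \<and> z \<in> T \<and> T \<subseteq> ?U" by (intro exI[of _ T] conjI subsetI) (simp_all only:)
  qed
  then have "open ?U" .
  have "{x0} \<times> cball 0 R \<subseteq> ?U"
  proof -
    have "a - e / 2 + p \<bullet> u < L x0 u" for u using ap(1)[of u] e2 by linarith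
    then show ?thesis by auto
  qed
  from Elementary_Topology.tube_lemma[OF compact_cball \<open>open ?U\<close> this]
  obtain B where B: "x0 \<in> B" "open B" "B \<times> cball 0 R \<subseteq> ?U" by (elim exE conjE) (rule that)
  show ?thesis
  proof (rule that[OF B(2,1)])
    show "(a - e / 2) + p \<bullet> u \<le> L x u" if "x \<in> B" for x u
    proof (cases "norm u \<le> R")
      case True
      then have "(x, u) \<in> B \<times> cball 0 R" using that by simp
      then have "(x, u) \<in> ?U" using B(3) by blast
      then show ?thesis by simp
    next
      case False
      have "a + p \<bullet> u \<le> \<bar>a\<bar> + norm p * norm u" using norm_cauchy_schwarz[of p u] by linarith
      also have "\<dots> \<le> (norm p + 1) * norm u - C" using False by (simp add: R_def algebra_simps)
      also have "\<dots> \<le> L x u" by (rule C)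
      finally show ?thesis using e2 by linarith
    qed
    show "L x0 u0 - e < (a - e / 2) + p \<bullet> u0" using ap(2) by simp
  qed
qed

lemma field_differentiable_imp_has_derivative_at:
  fixes f :: "real \<Rightarrow> real"
  shows "f field_differentiable (at x) \<Longrightarrow> (f has_vector_derivative deriv f x) (at x)"
  using field_differentiable_derivI has_real_derivative_iff_has_vector_derivative by blast

text \<open>Integrated form of \<open>L(y, y' / e') e' \<le> c'\<close>, where \<open>e\<close> is the elapsed time and \<open>c\<close> the
  accumulated cost along the curve \<open>y\<close>: as \<open>L\<close> is locally a supremum of affine minorants, it is tested
  against those. Unlike the differential inequality it survives uniform limits.\<close>

definition cost_dominates ::
    "('a::real_inner \<Rightarrow> 'a \<Rightarrow> real) \<Rightarrow> real \<Rightarrow> (real \<Rightarrow> real) \<Rightarrow> (real \<Rightarrow> 'a) \<Rightarrow> (real \<Rightarrow> real) \<Rightarrow> bool" where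
  "cost_dominates L T e y c \<longleftrightarrow>
     (\<forall>B a p s s'. open B \<and> (\<forall>x\<in>B. \<forall>u. a + p \<bullet> u \<le> L x u) \<and> 0 \<le> s \<and> s \<le> s' \<and> s' \<le> T \<and> y ` {s..s'} \<subseteq> B \<longrightarrow>
        a * (e s' - e s) + p \<bullet> (y s' - y s) \<le> c s' - c s)"

lemma cost_dominatesI:
  assumes "\<And>B a p s s'. \<lbrakk>open B; \<And>x u. x \<in> B \<Longrightarrow> a + p \<bullet> u \<le> L x u; 0 \<le> s; s \<le> s'; s' \<le> T;
      y ` {s..s'} \<subseteq> B\<rbrakk> \<Longrightarrow> a * (e s' - e s) + p \<bullet> (y s' - y s) \<le> c s' - c s"
  shows "cost_dominates L T e y c"
  unfolding cost_dominates_def by (intro allI impI, elim conjE, rule assms) blast+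

lemma cost_dominatesD:
  assumes "cost_dominates L T e y c" "open B" "\<And>x u. x \<in> B \<Longrightarrow> a + p \<bullet> u \<le> L x u" "0 \<le> s" "s \<le> s'" "s' \<le> T"
    "y ` {s..s'} \<subseteq> B"
  shows "a * (e s' - e s) + p \<bullet> (y s' - y s) \<le> c s' - c s"
  using assms(1)[unfolded cost_dominates_def, rule_format, of B a p s s'] assms(2-) by blast

section \<open>Regularity and running cost of a curve parametrized by time\<close>

context
  fixes L :: "'a::euclidean_space \<Rightarrow> 'a \<Rightarrow> real" and y :: "real \<Rightarrow> 'a" and c :: "real \<Rightarrow> real" and t :: real
  assumes t: "0 \<le> t" and L: "\<And>x u. 0 \<le> L x u"
    and growth: "\<And>N. 0 \<le> N \<Longrightarrow> \<exists>C\<ge>0. \<forall>x u. N * norm u - C \<le> L x u"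
    and dom: "cost_dominates L t (\<lambda>s. s) y c"
begin

lemmas minorant = cost_dominatesD[OF dom]

lemma cost_mono: "0 \<le> s \<Longrightarrow> s \<le> s' \<Longrightarrow> s' \<le> t \<Longrightarrow> c s \<le> c s'"
  using minorant[of UNIV 0 0 s s'] L by simp

text \<open>Test with the global minorant of slope N in the direction of y s' - y s. The slope N is
  arbitrary, at the expense of C; this carries the whole strength of superlinear growth.\<close>

lemma cost_controls_variation:
  assumes "0 \<le> N"
  shows "\<exists>C\<ge>0. \<forall>s s'. 0 \<le> s \<longrightarrow> s \<le> s' \<longrightarrow> s' \<le> t \<longrightarrow> N * norm (y s' - y s) \<le> c s' - c s + C * (s' - s)"
proof -
  obtain C where C: "0 \<le> C" "\<And>x u. N * norm u - C \<le> L x u" using growth[OF assms] by auto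
  have "N * norm (y s' - y s) \<le> c s' - c s + C * (s' - s)" if s: "0 \<le> s" "s \<le> s'" "s' \<le> t" for s s'
  proof -
    define p where "p = N *\<^sub>R sgn (y s' - y s)"
    have "norm p \<le> N" using assms by (simp add: p_def norm_sgn)
    have "- C + p \<bullet> u \<le> L x u" for x u
    proof -
      have "p \<bullet> u \<le> norm p * norm u" by (rule norm_cauchy_schwarz)
      also have "\<dots> \<le> N * norm u" using \<open>norm p \<le> N\<close> by (intro mult_right_mono) auto
      finally show ?thesis using C(2)[of u x] by linarith
    qed
    then have "- C * (s' - s) + p \<bullet> (y s' - y s) \<le> c s' - c s"
      using s by (intro minorant[of UNIV]) auto
    moreover have "p \<bullet> (y s' - y s) = N * norm (y s' - y s)"
      by (cases "y s' = y s")
        (auto simp: p_def sgn_div_norm power2_norm_eq_inner[symmetric] power2_eq_square divide_inverse)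
    ultimately show ?thesis by simp
  qed
  then show ?thesis using C(1) by blast
qed

text \<open>The theorems on monotone functions concern functions on the whole line, one of them
  constant to the right of the interval; freezing g outside [0, t] provides both.\<close>

definition clamped :: "(real \<Rightarrow> 'b) \<Rightarrow> real \<Rightarrow> 'b" where
  "clamped g s = g (max 0 (min t s))"

lemma mono_clamped:
  fixes g :: "real \<Rightarrow> real"
  assumes "\<And>s s'. 0 \<le> s \<Longrightarrow> s \<le> s' \<Longrightarrow> s' \<le> t \<Longrightarrow> g s \<le> g s'"
  shows "mono (clamped g)"
  unfolding clamped_def mono_def using t by (auto intro!: assms)

lemma mono_clamped_cost: "mono (clamped c)"
  by (rule mono_clamped) (rule cost_mono)

lemma clamped_eq: "s \<in> {0..t} \<Longrightarrow> clamped g s = g s"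
  by (simp add: clamped_def)

text \<open>As c may jump, smallness cannot come from its increments. Their sum is at most c t - c
  0, and N is chosen so large that this bound plus 1 is below N * \<epsilon>; then \<delta> = 1 / (C
  + 1) keeps the remaining term C * \<delta> below 1.\<close>

lemma trajectory_absolutely_continuous: "absolutely_continuous_fun_on {0..t} y"
  unfolding absolutely_continuous_fun_on_def
proof (intro allI impI)
  fix \<epsilon> :: real assume "0 < \<epsilon>"
  define N where "N = 2 * (c t - c 0 + 1) / \<epsilon>"
  have ct: "c 0 \<le> c t" using cost_mono t by simp
  have N: "N > 0" using \<open>0 < \<epsilon>\<close> ct by (simp add: N_def add_nonneg_pos)
  obtain C where C: "0 \<le> C"
    "\<And>s s'. 0 \<le> s \<Longrightarrow> s \<le> s' \<Longrightarrow> s' \<le> t \<Longrightarrow> N * norm (y s' - y s) \<le> c s' - c s + C * (s' - s)"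
    using cost_controls_variation[of N] N by auto
  have "(\<Sum>K\<in>d. norm (y (Sup K) - y (Inf K))) < \<epsilon>"
    if d: "d division_of T" "T \<subseteq> {0..t}" and small: "(\<Sum>K\<in>d. Sup K - Inf K) < 1 / (C + 1)" for d T
  proof -
    have K: "0 \<le> Inf K \<and> Inf K \<le> Sup K \<and> Sup K \<le> t" if K: "K \<in> d" for K
    proof -
      obtain u v where uv: "K = cbox u v" using division_ofD(4)[OF d(1) K] by auto
      moreover have "K \<noteq> {}" "K \<subseteq> T" using division_ofD(2,3)[OF d(1) K] by auto
      ultimately have "u \<le> v" "u \<in> {0..t}" "v \<in> {0..t}" using d(2) by (simp_all add: subset_eq)
      then show ?thesis using uv by auto
    qed
    have "N * (\<Sum>K\<in>d. norm (y (Sup K) - y (Inf K))) = (\<Sum>K\<in>d. N * norm (y (Sup K) - y (Inf K)))"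
      by (rule sum_distrib_left)
    also have "\<dots> \<le> (\<Sum>K\<in>d. (c (Sup K) - c (Inf K)) + C * (Sup K - Inf K))"
    proof (rule sum_mono)
      fix K assume "K \<in> d"
      from K[OF this] show "N * norm (y (Sup K) - y (Inf K)) \<le> (c (Sup K) - c (Inf K)) + C * (Sup K - Inf K)"
        by (intro C(2)) auto
    qed
    also have "\<dots> = (\<Sum>K\<in>d. c (Sup K) - c (Inf K)) + C * (\<Sum>K\<in>d. Sup K - Inf K)"
      by (simp add: sum.distrib sum_distrib_left)
    also have "(\<Sum>K\<in>d. c (Sup K) - c (Inf K)) = (\<Sum>K\<in>d. clamped c (Sup K) - clamped c (Inf K))"
    proof (rule sum.cong)
      fix K assume "K \<in> d"
      from K[OF this] show "c (Sup K) - c (Inf K) = clamped c (Sup K) - clamped c (Inf K)"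
        by (simp add: clamped_eq)
    qed simp
    also have "(\<Sum>K\<in>d. clamped c (Sup K) - clamped c (Inf K)) + C * (\<Sum>K\<in>d. Sup K - Inf K)
        \<le> (clamped c t - clamped c 0) + C * (1 / (C + 1))"
      using mono_sum_division_le[OF mono_clamped_cost d t] small C(1)
      by (intro add_mono mult_left_mono) auto
    also have "\<dots> < c t - c 0 + 1" using C(1) t by (simp add: clamped_eq field_simps)
    also have "c t - c 0 + 1 \<le> N * \<epsilon>" using \<open>0 < \<epsilon>\<close> ct by (simp add: N_def)
    finally show ?thesis using N by simp
  qed
  note sum_less = this
  show "\<exists>\<delta>>0. \<forall>d T. d division_of T \<and> T \<subseteq> {0..t} \<and> (\<Sum>K\<in>d. Sup K - Inf K) < \<delta> \<longrightarrow>
      (\<Sum>K\<in>d. norm (y (Sup K) - y (Inf K))) < \<epsilon>"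
  proof (rule exI[of _ "1 / (C + 1)"], intro conjI allI impI)
    show "0 < 1 / (C + 1)" using C(1) by simp
    show "(\<Sum>K\<in>d. norm (y (Sup K) - y (Inf K))) < \<epsilon>"
      if "d division_of T \<and> T \<subseteq> {0..t} \<and> (\<Sum>K\<in>d. Sup K - Inf K) < 1 / (C + 1)" for d T
      using that by (elim conjE) (rule sum_less)
  qed
qed

text \<open>With g s = c s + C * s dominating the variation of y, each coordinate of y is the
  difference of the monotone functions g + y . b and g.\<close>

lemma trajectory_differentiable_AE:
  "AE s in lebesgue. s \<in> {0<..<t} \<longrightarrow> (\<exists>D. (y has_vector_derivative D) (at s))"
proof -
  obtain C where C: "0 \<le> C"
    "\<And>s s'. 0 \<le> s \<Longrightarrow> s \<le> s' \<Longrightarrow> s' \<le> t \<Longrightarrow> norm (y s' - y s) \<le> c s' - c s + C * (s' - s)"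
    using cost_controls_variation[of 1] by auto
  define g where "g s = c s + C * s" for s
  have "g s \<le> g s'" if "0 \<le> s" "s \<le> s'" "s' \<le> t" for s s'
    using cost_mono[OF that] mult_left_mono[OF that(2) C(1)] by (simp add: g_def)
  then have "AE s in lebesgue. clamped g field_differentiable (at s)"
    by (intro mono_imp_differentiable_AE mono_clamped)
  moreover have "AE s in lebesgue. clamped (\<lambda>s. g s + y s \<bullet> b) field_differentiable (at s)" if "b \<in> Basis" for b
  proof (intro mono_imp_differentiable_AE mono_clamped)
    fix s s' assume s: "0 \<le> s" "s \<le> s'" "s' \<le> t"
    have "\<bar>(y s' - y s) \<bullet> b\<bar> \<le> g s' - g s"
      using C(2)[OF s] Basis_le_norm[OF that, of "y s' - y s"] by (simp add: g_def algebra_simps)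
    then show "g s + y s \<bullet> b \<le> g s' + y s' \<bullet> b" by (simp add: inner_diff_left)
  qed
  then have "AE s in lebesgue. \<forall>b\<in>Basis. clamped (\<lambda>s. g s + y s \<bullet> b) field_differentiable (at s)"
    by (intro AE_finite_allI) auto
  ultimately show ?thesis
  proof eventually_elim
    case (elim s)
    show ?case
    proof
      assume s: "s \<in> {0<..<t}"
      have "((\<lambda>s. clamped (\<lambda>s. g s + y s \<bullet> b) s - clamped g s) has_vector_derivative
          deriv (clamped (\<lambda>s. g s + y s \<bullet> b)) s - deriv (clamped g) s) (at s)" if "b \<in> Basis" for b
        using elim that by (intro derivative_intros field_differentiable_imp_has_derivative_at) auto
      then have *: "((\<lambda>s. y s \<bullet> b) has_vector_derivative
          deriv (clamped (\<lambda>s. g s + y s \<bullet> b)) s - deriv (clamped g) s) (at s)" if "b \<in> Basis" for b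
        by (rule has_vector_derivative_transform_within_open[OF _ open_greaterThanLessThan s])
          (use that in \<open>auto simp: clamped_eq\<close>)
      define D where "D = (\<Sum>b\<in>Basis. (deriv (clamped (\<lambda>s. g s + y s \<bullet> b)) s - deriv (clamped g) s) *\<^sub>R b)"
      have "(y has_vector_derivative D) (at s)"
        unfolding has_vector_derivative_def
      proof (subst has_derivative_componentwise_within, intro ballI)
        fix b :: 'a assume b: "b \<in> Basis"
        then have "D \<bullet> b = deriv (clamped (\<lambda>s. g s + y s \<bullet> b)) s - deriv (clamped g) s"
          by (simp add: D_def inner_sum_left_Basis)
        then show "((\<lambda>s. y s \<bullet> b) has_derivative (\<lambda>h. (h *\<^sub>R D) \<bullet> b)) (at s)"
          using *[OF b] by (simp add: has_vector_derivative_def)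
      qed
      then show "\<exists>D. (y has_vector_derivative D) (at s)" ..
    qed
  qed
qed

text \<open>Near s the curve stays in the neighbourhood of y s where an affine minorant is valid.
  Dividing its integrated inequality by s' - s and letting s' decrease to s gives a + p . u \<le> D,
  and the minorant is within e of L at u.\<close>

lemma lagrangian_le_cost_derivative:
  assumes lsc: "lower_semicontinuous_on UNIV (\<lambda>(x, u). L x u)"
    and conv: "\<And>x. convex_on UNIV (L x)"
    and s: "s \<in> {0<..<t}" and y': "(y has_vector_derivative u) (at s)" and c': "(clamped c has_field_derivative D) (at s)"
  shows "L (y s) u \<le> D"
proof (rule field_le_epsilon)
  fix e :: real assume "0 < e"
  obtain B a p where B: "open B" "y s \<in> B" "\<And>x u. x \<in> B \<Longrightarrow> a + p \<bullet> u \<le> L x u" "L (y s) u - e < a + p \<bullet> u"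
    using local_affine_minorant[OF lsc conv \<open>0 < e\<close> growth] by blast
  have "isCont y s" using y' has_vector_derivative_continuous by blast
  then have "\<forall>\<^sub>F s' in at s. y s' \<in> B"
    unfolding isCont_def using B(1,2) by (rule topological_tendstoD)
  then obtain d where d: "d > 0" "\<And>s'. s' \<noteq> s \<Longrightarrow> dist s' s < d \<Longrightarrow> y s' \<in> B"
    by (auto simp: eventually_at)
  define g where "g s' = clamped c s' - a * s' - p \<bullet> y s'" for s'
  have "((\<lambda>s'. p \<bullet> y s') has_field_derivative p \<bullet> u) (at s)"
    unfolding has_real_derivative_iff_has_vector_derivative
    by (rule bounded_linear.has_vector_derivative[OF bounded_linear_inner_right y'])
  then have "(g has_field_derivative D - a - p \<bullet> u) (at s)"
    unfolding g_def[abs_def] using c' by (auto intro!: derivative_eq_intros)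
  then have "((\<lambda>s'. (g s' - g s) / (s' - s)) \<longlongrightarrow> D - a - p \<bullet> u) (at_right s)"
    unfolding has_field_derivative_iff by (rule tendsto_mono[rotated]) (simp add: at_le)
  moreover have "\<forall>\<^sub>F s' in at_right s. 0 \<le> (g s' - g s) / (s' - s)"
  proof -
    have "0 \<le> (g s' - g s) / (s' - s)" if s': "s < s'" "s' < min t (s + d)" for s'
    proof -
      have "a * (s' - s) + p \<bullet> (y s' - y s) \<le> c s' - c s"
      proof (rule minorant[OF B(1,3)])
        have "y r \<in> B" if "r \<in> {s..s'}" for r
          using that s' B(2) d(2)[of r] by (cases "r = s") (auto simp: dist_real_def)
        then show "y ` {s..s'} \<subseteq> B" by blast
      qed (use s s' in auto)
      then show ?thesis
        using s s' by (simp add: g_def clamped_eq algebra_simps)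
    qed
    moreover have "s < min t (s + d)" using s d by auto
    ultimately show ?thesis unfolding eventually_at_right_field by blast
  qed
  ultimately have "0 \<le> D - a - p \<bullet> u" by (rule tendsto_lowerbound) simp
  then show "L (y s) u \<le> D + e" using B(4) by simp
qed

lemma running_cost_le:
  assumes lsc: "lower_semicontinuous_on UNIV (\<lambda>(x, u). L x u)"
    and conv: "\<And>x. convex_on UNIV (L x)"
  shows "(\<integral>\<^sup>+ s\<in>{0..t}. ennreal (L (y s) (vector_derivative y (at s within {0..t}))) \<partial>lebesgue) \<le> ennreal (c t - c 0)"
proof -
  have "AE s in lebesgue. clamped c field_differentiable (at s)"
    by (intro mono_imp_differentiable_AE mono_clamped_cost)
  with trajectory_differentiable_AE
  have "AE s in lebesgue. s \<in> {0<..<t} \<longrightarrow> (\<exists>D. (clamped c has_field_derivative D) (at s) \<and>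
      L (y s) (vector_derivative y (at s within {0..t})) \<le> D)"
  proof eventually_elim
    case (elim s)
    show ?case
    proof
      assume s: "s \<in> {0<..<t}"
      obtain D u where D: "(clamped c has_field_derivative D) (at s)" and u: "(y has_vector_derivative u) (at s)"
        using elim s by (auto simp: field_differentiable_def)
      have "vector_derivative y (at s within {0..t}) = u"
        using s u by (intro vector_derivative_within_cbox[of 0 t, simplified]) 
          (auto intro: has_vector_derivative_at_within)
      then show "\<exists>D. (clamped c has_field_derivative D) (at s) \<and>
          L (y s) (vector_derivative y (at s within {0..t})) \<le> D"
        using lagrangian_le_cost_derivative[OF lsc conv s u D] D by auto
    qed
  qed
  then have "(\<integral>\<^sup>+ s\<in>{0..t}. ennreal (L (y s) (vector_derivative y (at s within {0..t}))) \<partial>lebesgue)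
      \<le> ennreal (clamped c t - clamped c 0)"
    using t by (intro mono_nn_integral_derivative_le[OF mono_clamped_cost]) (simp_all add: clamped_def)
  then show ?thesis using t by (simp add: clamped_eq)
qed

end


text \<open>Well defined because, by superlinearity, the position cannot move while time stands still.\<close>

lemma time_reparametrization:
  fixes L :: "'a::euclidean_space \<Rightarrow> 'a \<Rightarrow> real" and \<theta> k :: "real \<Rightarrow> real" and x :: "real \<Rightarrow> 'a"
  assumes "0 \<le> T" "continuous_on {0..T} \<theta>" "\<theta> 0 = t" "\<theta> T = 0"
    and L: "\<And>x u. 0 \<le> L x u" and growth: "\<And>N. 0 \<le> N \<Longrightarrow> \<exists>C\<ge>0. \<forall>x u. N * norm u - C \<le> L x u"
    and \<theta>_mono: "\<And>\<tau> \<tau>'. \<lbrakk>0 \<le> \<tau>; \<tau> \<le> \<tau>'; \<tau>' \<le> T\<rbrakk> \<Longrightarrow> \<theta> \<tau>' \<le> \<theta> \<tau>"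
    and dom: "cost_dominates L T (\<lambda>\<tau>. - \<theta> \<tau>) x k"
  obtains y c \<tau> where "y 0 = x 0" "k 0 \<le> c 0" "\<tau> \<in> {0..T}" "\<theta> \<tau> = 0" "y t = x \<tau>" "c t = k \<tau>"
    "cost_dominates L t (\<lambda>s. s) y c"
proof -
  note minorant = cost_dominatesD[OF dom]
  have t: "0 \<le> t" using \<theta>_mono[of 0 T] assms(1,3,4) by simp
  have still: "x \<tau> = x \<tau>'" if \<tau>: "0 \<le> \<tau>" "\<tau> \<le> \<tau>'" "\<tau>' \<le> T" "\<theta> \<tau> = \<theta> \<tau>'" for \<tau> \<tau>'
  proof (rule ccontr)
    assume "x \<tau> \<noteq> x \<tau>'"
    define d where "d = x \<tau>' - x \<tau>"
    have d: "0 < d \<bullet> d" using \<open>x \<tau> \<noteq> x \<tau>'\<close> by (simp add: d_def)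
    \<comment> \<open>When time stands still the term in a vanishes, and slope n * d would give n *
      (d . d) \<le> k \<tau>' - k \<tau> for every n.\<close>
    obtain n :: nat where n: "k \<tau>' - k \<tau> < real n * (d \<bullet> d)"
      using reals_Archimedean3[OF d] by blast
    define p where "p = real n *\<^sub>R d"
    obtain C where C: "\<And>x u. norm p * norm u - C \<le> L x u" using growth[of "norm p"] by auto
    have "- C * (- \<theta> \<tau>' - - \<theta> \<tau>) + p \<bullet> (x \<tau>' - x \<tau>) \<le> k \<tau>' - k \<tau>"
    proof (rule minorant[of UNIV])
      show "- C + p \<bullet> u \<le> L x u" for x u using C[of u x] norm_cauchy_schwarz[of p u] by linarith
    qed (use \<tau> in auto)
    then show False using n \<tau>(4) by (simp add: p_def d_def)
  qed
  have "\<exists>\<tau>. 0 \<le> \<tau> \<and> \<tau> \<le> T \<and> \<theta> \<tau> = t - s" if "0 \<le> s" "s \<le> t" for s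
    using IVT2'[of \<theta> T "t - s" 0] assms(1-4) that by auto
  \<comment> \<open>Any parameter at which the elapsed time t - \<theta> equals s. By
    \<open>still\<close> the position does not depend on the choice; the cost may, but every choice
    is increasing in s, which suffices.\<close>
  then obtain \<sigma> where \<sigma>: "\<And>s. 0 \<le> s \<Longrightarrow> s \<le> t \<Longrightarrow> 0 \<le> \<sigma> s \<and> \<sigma> s \<le> T \<and> \<theta> (\<sigma> s) = t - s"
    by metis
  have eq: "x (\<sigma> (t - \<theta> \<tau>)) = x \<tau>" if \<tau>: "0 \<le> \<tau>" "\<tau> \<le> T" for \<tau>
  proof -
    have "0 \<le> \<theta> \<tau>" "\<theta> \<tau> \<le> t" using \<theta>_mono[of 0 \<tau>] \<theta>_mono[of \<tau> T] \<tau> assms(3,4) by auto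
    then have \<sigma>\<tau>: "0 \<le> \<sigma> (t - \<theta> \<tau>)" "\<sigma> (t - \<theta> \<tau>) \<le> T" "\<theta> (\<sigma> (t - \<theta> \<tau>)) = \<theta> \<tau>"
      using \<sigma>[of "t - \<theta> \<tau>"] by auto
    show ?thesis
    proof (cases "\<tau> \<le> \<sigma> (t - \<theta> \<tau>)")
      case True
      from still[OF \<tau>(1) this \<sigma>\<tau>(2)] show ?thesis using \<sigma>\<tau>(3) by simp
    next
      case False
      then show ?thesis using \<sigma>\<tau> \<tau>(2) by (intro still) auto
    qed
  qed
  show thesis
  proof (rule that[of "\<lambda>s. x (\<sigma> s)" "\<lambda>s. k (\<sigma> s)" "\<sigma> t"])
    show "x (\<sigma> 0) = x 0" using eq[of 0] assms(1,3) by simp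
    show "k 0 \<le> k (\<sigma> 0)" using minorant[of UNIV 0 0 0 "\<sigma> 0"] \<sigma>[of 0] L t by simp
    show "\<sigma> t \<in> {0..T}" "\<theta> (\<sigma> t) = 0" using \<sigma>[of t] t by auto
    show "cost_dominates L t (\<lambda>s. s) (\<lambda>s. x (\<sigma> s)) (\<lambda>s. k (\<sigma> s))"
    proof (rule cost_dominatesI)
      fix B a p s s'
      assume B: "open B" "\<And>x u. x \<in> B \<Longrightarrow> a + p \<bullet> u \<le> L x u" and s: "0 \<le> s" "s \<le> s'" "s' \<le> t"
        and sub: "(\<lambda>s. x (\<sigma> s)) ` {s..s'} \<subseteq> B"
      have \<sigma>s: "0 \<le> \<sigma> s" "\<sigma> s \<le> T" "\<theta> (\<sigma> s) = t - s" "0 \<le> \<sigma> s'" "\<sigma> s' \<le> T" "\<theta> (\<sigma> s') = t - s'"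
        using \<sigma>[of s] \<sigma>[of s'] s by auto
      show "a * (s' - s) + p \<bullet> (x (\<sigma> s') - x (\<sigma> s)) \<le> k (\<sigma> s') - k (\<sigma> s)"
      proof (cases "s = s'")
        case False
        then have le: "\<sigma> s \<le> \<sigma> s'"
          using \<theta>_mono[of "\<sigma> s'" "\<sigma> s"] \<sigma>s s(2) by (cases "\<sigma> s \<le> \<sigma> s'") auto
        \<comment> \<open>The hypothesis only covers the selected parameters; \<open>eq\<close>
          transfers it to all parameters in between.\<close>
        have "x \<tau> \<in> B" if "\<tau> \<in> {\<sigma> s..\<sigma> s'}" for \<tau>
        proof -
          have "t - s' \<le> \<theta> \<tau>" "\<theta> \<tau> \<le> t - s"
            using \<theta>_mono[of "\<sigma> s" \<tau>] \<theta>_mono[of \<tau> "\<sigma> s'"] that \<sigma>s by auto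
          then have "t - \<theta> \<tau> \<in> {s..s'}" by auto
          then have "x (\<sigma> (t - \<theta> \<tau>)) \<in> B" using sub by blast
          then show ?thesis using eq[of \<tau>] that \<sigma>s by auto
        qed
        then have "a * (- \<theta> (\<sigma> s') - - \<theta> (\<sigma> s)) + p \<bullet> (x (\<sigma> s') - x (\<sigma> s)) \<le> k (\<sigma> s') - k (\<sigma> s)"
          using le \<sigma>s by (intro minorant[OF B]) auto
        then show ?thesis by (simp add: \<sigma>s)
      qed simp
    qed
  qed auto
qed

section \<open>Comparison with the value function\<close>

theorem theorem1p7:
  fixes \<phi> :: "real ^ 'n \<Rightarrow> ereal"
    and L :: "real ^ 'n \<Rightarrow> real ^ 'n \<Rightarrow> real"
    and \<Theta> :: "real ^ 'n \<Rightarrow> real"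
    and W :: "real \<times> (real ^ 'n) \<Rightarrow> ereal"
  assumes "\<forall>x. 0 \<le> \<phi> x"
    and "lower_semicontinuous_on UNIV \<phi>"
    and "\<forall>x u. 0 \<le> L x u"
    and "locally_bounded (\<lambda>(x, u). L x u)"
    and "lower_semicontinuous_on UNIV (\<lambda>(x, u). L x u)"
    and "\<forall>x. convex_on UNIV (L x)"
    and "\<forall>u. 0 \<le> \<Theta> u"
    and "filterlim (\<lambda>u. \<Theta> u / norm u) at_top at_infinity"
    and "\<forall>x u. \<Theta> u \<le> L x u"
    and "\<forall>t\<ge>0. \<forall>x. 0 \<le> W (t, x)"
    and "lower_semicontinuous_on ({0..} \<times> UNIV) W"
    and "\<forall>t>0. \<forall>x. (t, x) \<in> finite_dom W \<longrightarrow> contingent_derivative W (t, x) (0, 0) = 0"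
    and "\<forall>t>0. \<forall>x. (t, x) \<in> finite_dom W \<longrightarrow>
           (\<exists>u. contingent_derivative W (t, x) (-1, u) < \<infinity>)"
    and "\<forall>x. W (0, x) = \<phi> x"
    and "\<forall>t>0. \<forall>x. \<forall>(p\<^sub>t, p\<^sub>x) \<in> subdifferential W (t, x). ereal p\<^sub>t + hamiltonian L x (- p\<^sub>x) \<ge> 0"
  shows "\<forall>t\<ge>0. \<forall>x. W (t, x) \<ge> value_function L \<phi> t x"
proof (intro allI impI)
  fix t0 :: real and x0 :: "real ^ 'n"
  assume t0: "0 \<le> t0"
  have L: "0 \<le> L x u" for x u using assms(3) by blast
  have conv: "convex_on UNIV (L x)" for x using assms(6) by blast
  have growth: "\<exists>C\<ge>0. \<forall>x u. N * norm u - C \<le> L x u" if "0 \<le> N" for N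
  proof -
    obtain C where "0 \<le> C" "\<And>u. N * norm u - C \<le> \<Theta> u"
      using superlinear_ge[of \<Theta> N] assms(7,8) \<open>0 \<le> N\<close> by blast
    then show ?thesis using assms(9) by (intro exI[of _ C]) (meson order_trans)
  qed
  define S where "S = {0 :: real..} \<times> (UNIV :: (real ^ 'n) set)"
  have W: "0 \<le> W z" if "z \<in> S" for z using that assms(10) by (auto simp: S_def)
  have int: "(t, x) \<in> interior S" if "0 < t" for t x
  proof (rule interiorI)
    show "open ({0 :: real <..} \<times> (UNIV :: (real ^ 'n) set))" by (intro open_Times) auto
  qed (use that in \<open>auto simp: S_def\<close>)
  have "W (t0, x0) \<in> {0..}" using W t0 by (auto simp: S_def)
  then consider "W (t0, x0) = \<infinity>" | w0 where "W (t0, x0) = ereal w0" "0 \<le> w0"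
    by (cases "W (t0, x0)") auto
  then show "value_function L \<phi> t0 x0 \<le> W (t0, x0)"
  proof cases
    case (2 w0)
    let ?K = "ereal_epigraph S W"
    have "closed S" unfolding S_def by (intro closed_Times) auto
    then have K: "closed ?K" using assms(11) by (auto simp: S_def intro: closed_epigraph)
    have z0: "((t0, x0), w0) \<in> ?K" using 2 t0 by (auto simp: ereal_epigraph_def S_def)
    define F where "F z = range (direction L (snd (fst z)))" for z :: "(real \<times> (real ^ 'n)) \<times> real"
    define Stop where "Stop = {z :: (real \<times> (real ^ 'n)) \<times> real. fst (fst z) \<le> 0}"
    \<comment> \<open>Time plus height starts at t0 + w0, falls at unit rate and is nonnegative on
      the epigraph; the summand 1 gives the strict inequality for the clock.\<close>
    define T where "T = t0 + w0 + 1"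
    obtain C where C: "0 \<le> C" "\<And>x u. norm u - C \<le> L x u" using growth[of 1] by auto
    have "closed Stop" unfolding Stop_def by (intro closed_Collect_le continuous_intros)
    \<comment> \<open>From norm u \<le> C + L the undivided direction has norm at most 1 + C + 2 * L
      \<le> (2 + C) * (1 + L).\<close>
    have bound: "norm (direction L x u) \<le> 2 + C" for x u
    proof -
      have "norm ((- 1 :: real, u), - L x u) \<le> norm (- 1 :: real, u) + norm (- L x u)" by (rule norm_Pair_le)
      also have "norm (- 1 :: real, u) \<le> norm (- 1 :: real) + norm u" by (rule norm_Pair_le)
      also have "norm (- 1 :: real) + norm u + norm (- L x u) \<le> (2 + C) * (1 + L x u)"
        using C(2)[of u x] L[of x u] mult_nonneg_nonneg[OF C(1) L[of x u]] by (simp add: algebra_simps)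
      finally show ?thesis
        unfolding direction_def norm_scaleR using L[of x u] by (simp add: pos_divide_le_eq)
    qed
    have aim: "\<exists>v\<in>F (closest_point ?K z). v \<bullet> (z - closest_point ?K z) \<le> \<epsilon>"
      if "closest_point ?K z \<notin> Stop" "0 < \<epsilon>" for z \<epsilon>
    proof -
      obtain t x w where s: "closest_point ?K z = ((t, x), w)" by (metis surj_pair)
      have t: "0 < t" using that(1) by (simp add: s Stop_def)
      have "\<exists>u0. (t, x) \<in> finite_dom W \<longrightarrow> contingent_derivative W (t, x) (-1, u0) < \<infinity>"
        using assms(13) t by blast
      then obtain u0 where u0: "(t, x) \<in> finite_dom W \<Longrightarrow> contingent_derivative W (t, x) (-1, u0) < \<infinity>" by blast
      have super: "0 \<le> ereal pt + hamiltonian L x (- px)" if "(pt, px) \<in> subdifferential W (t, x)" for pt px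
        using assms(15) t that by fastforce
      have "\<exists>u. direction L x u \<bullet> (z - ((t, x), w)) \<le> \<epsilon>"
      proof (rule epigraph_aiming[where L = L, OF L W K _ s int[OF t] u0 super \<open>0 < \<epsilon>\<close>])
        show "?K \<noteq> {}" using z0 by blast
      qed
      then show ?thesis unfolding s F_def by auto
    qed
    have "0 < T" using t0 2 by (simp add: T_def)
    obtain \<gamma> where \<gamma>: "continuous_on {0..T} \<gamma>" "\<gamma> 0 = ((t0, x0), w0)" "\<And>\<tau>. \<tau> \<in> {0..T} \<Longrightarrow> \<gamma> \<tau> \<in> ?K" "\<gamma> T \<in> Stop"
      and desc: "\<And>B g \<tau> \<tau>'. \<lbrakk>open B; \<And>s v. \<lbrakk>s \<in> ?K; s \<in> B; v \<in> F s\<rbrakk> \<Longrightarrow> g \<bullet> v \<le> 0; 0 \<le> \<tau>; \<tau> \<le> \<tau>'; \<tau>' \<le> T;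
        \<gamma> ` {\<tau>..\<tau>'} \<subseteq> B\<rbrakk> \<Longrightarrow> g \<bullet> \<gamma> \<tau>' \<le> g \<bullet> \<gamma> \<tau>"
    proof (rule viability[OF K z0 \<open>closed Stop\<close> \<open>0 < T\<close>, of "2 + C" F "((1, 0), 1)"])
      show "((1, 0), 1) \<bullet> v \<le> - 1" if vF: "v \<in> F s" for s v
      proof -
        obtain x u where v: "v = direction L x u" using vF by (auto simp: F_def)
        have "((1, 0), 1) \<bullet> v = (- 1 - L x u) / (1 + L x u)"
          unfolding v direction_def by (simp add: inner_Pair diff_divide_distrib)
        also have "\<dots> = - 1" using L[of x u] by (simp add: field_simps)
        finally show ?thesis by simp
      qed
      show "0 \<le> ((1, 0), 1) \<bullet> s" if "s \<in> ?K" for s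
      proof -
        obtain t x w where s: "s = ((t, x), w)" by (metis surj_pair)
        have "0 \<le> W (t, x)" "W (t, x) \<le> ereal w" and t: "0 \<le> t"
          using that W[of "(t, x)"] by (auto simp: s ereal_epigraph_def S_def)
        then have "0 \<le> w" using order_trans[of 0 "W (t, x)" "ereal w"] by simp
        with t show ?thesis by (simp add: s inner_Pair)
      qed
    qed (use aim bound C(1) in \<open>auto simp: F_def T_def inner_Pair\<close>)
    define \<theta> x w where "\<theta> \<tau> = fst (fst (\<gamma> \<tau>))" and "x \<tau> = snd (fst (\<gamma> \<tau>))" and "w \<tau> = snd (\<gamma> \<tau>)" for \<tau>
    have \<gamma>_eq: "\<gamma> \<tau> = ((\<theta> \<tau>, x \<tau>), w \<tau>)" for \<tau> by (simp add: \<theta>_def x_def w_def)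
    have "\<theta> T = 0" using \<gamma>(3)[of T] \<gamma>(4) \<open>0 < T\<close> by (auto simp: \<gamma>_eq ereal_epigraph_def S_def Stop_def)
    have \<theta>_mono: "\<theta> \<tau>' \<le> \<theta> \<tau>" if "0 \<le> \<tau>" "\<tau> \<le> \<tau>'" "\<tau>' \<le> T" for \<tau> \<tau>'
    proof -
      \<comment> \<open>The functional reading off time is nonpositive on all directions, so time
        never increases along \<gamma>.\<close>
      have "((1, 0), 0) \<bullet> direction L x u \<le> 0" for x u
        using L[of x u] by (simp add: direction_def inner_Pair)
      then have "((1, 0), 0) \<bullet> \<gamma> \<tau>' \<le> ((1, 0), 0) \<bullet> \<gamma> \<tau>"
        using that by (intro desc[of UNIV]) (auto simp: F_def)
      then show ?thesis by (simp add: \<gamma>_eq inner_Pair)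
    qed
    have dom: "cost_dominates L T (\<lambda>\<tau>. - \<theta> \<tau>) x (\<lambda>\<tau>. - w \<tau>)"
    proof (rule cost_dominatesI)
      fix B a p \<tau> \<tau>'
      assume "open B" and B: "\<And>x u. x \<in> B \<Longrightarrow> a + p \<bullet> u \<le> L x u" and \<tau>: "0 \<le> \<tau>" "\<tau> \<le> \<tau>'" "\<tau>' \<le> T"
        and sub: "x ` {\<tau>..\<tau>'} \<subseteq> B"
      \<comment> \<open>On a direction this functional equals (a + p . u - L) / (1 + L), so its sign
        is exactly the minorant inequality, and its descent along \<gamma> is the inequality
        required for the cost.\<close>
      have "((- a, p), 1) \<bullet> direction L x u \<le> 0" if "x \<in> B" for x u
      proof -
        have "((- a, p), 1) \<bullet> direction L x u = (a + p \<bullet> u - L x u) / (1 + L x u)"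
          by (simp add: direction_def inner_Pair add_divide_distrib diff_divide_distrib)
        then show ?thesis using B[OF that, of u] L[of x u] by (simp add: divide_nonpos_nonneg)
      qed
      then have "((- a, p), 1) \<bullet> \<gamma> \<tau>' \<le> ((- a, p), 1) \<bullet> \<gamma> \<tau>"
        using \<tau> sub \<open>open B\<close> by (intro desc[of "(UNIV \<times> B) \<times> UNIV"] open_Times) (auto simp: F_def \<gamma>_eq)
      then show "a * (- \<theta> \<tau>' - - \<theta> \<tau>) + p \<bullet> (x \<tau>' - x \<tau>) \<le> - w \<tau>' - - w \<tau>"
        by (simp add: \<gamma>_eq inner_Pair inner_diff_right algebra_simps)
    qed
    have "continuous_on {0..T} \<theta>" unfolding \<theta>_def by (intro continuous_intros \<gamma>(1))
    obtain y c \<tau> where y: "y 0 = x 0" "- w 0 \<le> c 0" "\<tau> \<in> {0..T}" "\<theta> \<tau> = 0" "y t0 = x \<tau>" "c t0 = - w \<tau>"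
      and dom': "cost_dominates L t0 (\<lambda>s. s) y c"
      using time_reparametrization[where L = L, OF less_imp_le[OF \<open>0 < T\<close>] \<open>continuous_on {0..T} \<theta>\<close> _ \<open>\<theta> T = 0\<close> L growth
          \<theta>_mono dom, of t0] \<gamma>(2) unfolding \<gamma>_eq by blast
    have "absolutely_continuous_fun_on {0..t0} y"
      using trajectory_absolutely_continuous[where L = L and c = c, OF t0 L growth dom'] .
    moreover have "y 0 = x0" using y(1) \<gamma>(2) by (simp add: \<gamma>_eq)
    ultimately have "value_function L \<phi> t0 x0 \<le> trajectory_cost L \<phi> t0 y"
      unfolding value_function_def by (intro INF_lower) simp
    \<comment> \<open>The running cost is at most c t0 - c 0. The terminal cost is at most w \<tau>
      = - c t0, because \<gamma> \<tau> is in the epigraph at time 0. The sum is - c 0 \<le>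
      w0.\<close>
    also have "\<dots> \<le> ereal (c t0 - c 0) + ereal (- c t0)"
      unfolding trajectory_cost_def
    proof (rule add_mono)
      have "c 0 \<le> c t0" using cost_mono[where L = L and y = y, OF t0 L growth dom'] t0 by blast
      have "(\<integral>\<^sup>+ s\<in>{0..t0}. ennreal (L (y s) (vector_derivative y (at s within {0..t0}))) \<partial>lebesgue)
          \<le> ennreal (c t0 - c 0)"
        using running_cost_le[where L = L, OF t0 L growth dom' assms(5) conv] .
      then have "enn2ereal (\<integral>\<^sup>+ s\<in>{0..t0}. ennreal (L (y s) (vector_derivative y (at s within {0..t0}))) \<partial>lebesgue)
          \<le> enn2ereal (ennreal (c t0 - c 0))" by (simp only: less_eq_ennreal.rep_eq)
      then show "enn2ereal (\<integral>\<^sup>+ s\<in>{0..t0}. ennreal (L (y s) (vector_derivative y (at s within {0..t0}))) \<partial>lebesgue)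
          \<le> ereal (c t0 - c 0)" using \<open>c 0 \<le> c t0\<close> by (simp add: enn2ereal_ennreal)
      have "W (0, x \<tau>) \<le> ereal (w \<tau>)" using \<gamma>(3)[OF y(3)] y(4) by (simp add: \<gamma>_eq ereal_epigraph_def)
      then show "\<phi> (y t0) \<le> ereal (- c t0)" using assms(14) y(5,6) by simp
    qed
    also have "\<dots> \<le> W (t0, x0)" using y(2) \<gamma>(2) 2 by (simp add: \<gamma>_eq)
    finally show ?thesis .
  qed simp
qed

end
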